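(* Let $\tau$ be a finite relational signature in which every relation symbol has arity two, let $\mathcal{P}$ be a nonempty hereditary and extendable $\tau$-property, and let $S_{\mathcal{P}}(\delta)$ denote its one-sided induced-sampling complexity. Fix $\rho\in(0,1]$ and $0<\varepsilon\le\rho^2/8$, and put $\delta=\varepsilon/(4\rho^2)$. Then $\mathrm{Large}_\rho(\mathcal{P})$ has a two-sided induced-sampling tester (at proximity parameter $\varepsilon$) using $$\widetilde O\!\left(\frac{\rho^2}{\varepsilon^2}\,S_{\mathcal{P}}(\delta)^2\log\frac{2}{\rho}\right)$$ vertices.
   Context: A finite relational signature $\tau$ is a finite list of relation symbols $R$, each with a positive integer arity $a(R)$. A finite $\tau$-structure $\mathcal{A}$ is a finite vertex set $V(\mathcal{A})$ together with relations $R^{\mathcal{A}}\subseteq V(\mathcal{A})^{a(R)}$ for $R\in\tau$. For $U\subseteq V(\mathcal{A})$, the induced substructure $\mathcal{A}[U]$ restricts every relation to tuples with all entries in $U$. A $\tau$-property is a family of finite $\tau$-structures closed under isomorphism; it is hereditary if $\mathcal{A}\in\mathcal{P}$ implies $\mathcal{A}[U]\in\mathcal{P}$ for every $U\subseteq V(\mathcal{A})$; it is extendable if for every $\mathcal{A}\in\mathcal{P}$ and $m\ge0$ there is $\mathcal{B}\in\mathcal{P}$ on $|V(\mathcal{A})|+m$ vertices containing $\mathcal{A}$ as an induced substructure. $\mathrm{Large}_\rho(\mathcal{P})=\{\mathcal{A}:\text{there exists }U\subseteq V(\mathcal{A})\text{ with }|U|\ge\rho|V(\mathcal{A})|\text{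 and }\mathcal{A}[U]\in\mathcal{P}\}$. Distance: for $\tau$-structures on the same $n$-element vertex set, $d_\tau(\mathcal{A},\mathcal{B})=\frac1{|\tau|}\sum_{R\in\tau}\frac{|R^{\mathcal{A}}\triangle R^{\mathcal{B}}|}{n^{a(R)}}$. $\mathcal{A}$ is $\varepsilon$-far from a property if the minimum of $d_\tau(\mathcal{A},\mathcal{B})$ over members $\mathcal{B}$ of the property on the same vertex set exceeds $\varepsilon$. An oblivious induced-sampling tester for a property consists, for every $\varepsilon>0$, of an integer $s(\varepsilon)$ and a collection $\mathcal{R}_\varepsilon$ of isomorphism types of $\tau$-structures on $s(\varepsilon)$ vertices. On input $\mathcal{A}$ with $|V(\mathcal{A})|\ge s(\varepsilon)$ it chooses a uniformly random $S\in\binom{V(\mathcal{A})}{s(\varepsilon)}$, reveals $\mathcal{A}[S]$, and rejects iff $\mathcal{A}[S]\in\mathcal{R}_\varepsilon$; if $|V(\mathcal{A})|<s(\varepsilon)$ it may inspect the whole input and decide membership exactly. It is sound if it rejects every $\varepsilon$-far input with probability at least $2/3$. It is one-sided if it is sound and always accepts members of the property; it is two-sided if it is sound and accepts every member of the property with probability at least $2/3$. Its sample complexity is $s(\varepsilon)$; "one-sided induced-sampling complexity $S_{\mathcal{P}}$" means that $\mathcal{P}$ has a one-sided induced-sampling tester with sample complexity $S_{\mathcal{P}}$. Complexity bounds are tacitly taken nonincreasing in the proximity parameter. $\widetilde O(\cdot)$ hides polylogarithmic factors in the displayed quantities. *)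

theory Defs
  imports "HOL-Probability.Probability"
begin

text \<open>
  A signature is the list of the arities of its relation symbols; the symbols are the positions of
  the list. A structure carries one relation, a set of tuples (lists) of vertices, per symbol.
  Every finite structure is isomorphic to one with vertices in \<^typ>\<open>nat\<close>, so families of
  structures over \<^typ>\<open>nat\<close> that are closed under isomorphism represent arbitrary properties.
\<close>

type_synonym signature = "nat list"

record 'v rel_structure =
  verts :: "'v set"
  rels :: "'v list set list"

definition structures :: "signature \<Rightarrow> 'v rel_structure set" where
  "structures \<tau> = {A. finite (verts A) \<and> length (rels A) = length \<tau> \<and>
     (\<forall>i<length \<tau>. rels A ! i \<subseteq> {t. length t = \<tau> ! i \<and> set t \<subseteq> verts A})}"

definition induced :: "'v rel_structure \<Rightarrow> 'v set \<Rightarrow> 'v rel_structure" where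
  "induced A U = \<lparr>verts = U, rels = map (\<lambda>R. {t \<in> R. set t \<subseteq> U}) (rels A)\<rparr>"

definition isomorphic :: "'v rel_structure \<Rightarrow> 'v rel_structure \<Rightarrow> bool" where
  "isomorphic A B \<longleftrightarrow>
     (\<exists>f. bij_betw f (verts A) (verts B) \<and> rels B = map (\<lambda>R. map f ` R) (rels A))"

definition is_property :: "signature \<Rightarrow> 'v rel_structure set \<Rightarrow> bool" where
  "is_property \<tau> P \<longleftrightarrow> P \<subseteq> structures \<tau> \<and>
     (\<forall>A\<in>P. \<forall>B\<in>structures \<tau>. isomorphic A B \<longrightarrow> B \<in> P)"

definition hereditary :: "'v rel_structure set \<Rightarrow> bool" where
  "hereditary P \<longleftrightarrow> (\<forall>A\<in>P. \<forall>U\<subseteq>verts A. induced A U \<in> P)"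

definition extendable :: "'v rel_structure set \<Rightarrow> bool" where
  "extendable P \<longleftrightarrow> (\<forall>A\<in>P. \<forall>m::nat. \<exists>B\<in>P. card (verts B) = card (verts A) + m \<and>
     verts A \<subseteq> verts B \<and> induced B (verts A) = A)"

definition Large :: "signature \<Rightarrow> real \<Rightarrow> 'v rel_structure set \<Rightarrow> 'v rel_structure set" where
  "Large \<tau> \<rho> P = {A \<in> structures \<tau>. \<exists>U\<subseteq>verts A.
     real (card U) \<ge> \<rho> * real (card (verts A)) \<and> induced A U \<in> P}"

definition struct_dist :: "signature \<Rightarrow> 'v rel_structure \<Rightarrow> 'v rel_structure \<Rightarrow> real" where
  "struct_dist \<tau> A B = 1 / real (length \<tau>) *
     (\<Sum>i<length \<tau>. real (card ((rels A ! i - rels B ! i) \<union> (rels B ! i - rels A ! i)))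
        / real (card (verts A)) ^ (\<tau> ! i))"

text \<open>
  The minimum over the finitely many members of the property on the same vertex set exceeds
  \<open>\<epsilon>\<close>; it counts as infinite if there is no such member.
\<close>

definition eps_far :: "signature \<Rightarrow> 'v rel_structure set \<Rightarrow> real \<Rightarrow> 'v rel_structure \<Rightarrow> bool" where
  "eps_far \<tau> P \<epsilon> A \<longleftrightarrow> (\<forall>B\<in>P. verts B = verts A \<longrightarrow> struct_dist \<tau> A B > \<epsilon>)"

text \<open>
  A sampler with parameters \<open>s\<close> and \<open>Rej\<close> is an oblivious induced-sampling tester at one fixed
  proximity parameter: \<open>s\<close> is the sample size, and the collection of rejected isomorphism types is
  represented by the isomorphism-closed set \<open>Rej\<close>. Sample sizes are positive integers. Inputs with
  fewer than \<open>s\<close> vertices are decided exactly, so they impose no condition below.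
\<close>

definition sampler :: "signature \<Rightarrow> nat \<Rightarrow> 'v rel_structure set \<Rightarrow> bool" where
  "sampler \<tau> s Rej \<longleftrightarrow> 0 < s \<and> is_property \<tau> Rej \<and> (\<forall>F\<in>Rej. card (verts F) = s)"

definition random_subset :: "'v rel_structure \<Rightarrow> nat \<Rightarrow> 'v set pmf" where
  "random_subset A s = pmf_of_set {X. X \<subseteq> verts A \<and> card X = s}"

definition reject_prob :: "'v rel_structure \<Rightarrow> nat \<Rightarrow> 'v rel_structure set \<Rightarrow> real" where
  "reject_prob A s Rej = measure_pmf.prob (random_subset A s) {X. induced A X \<in> Rej}"

definition accept_prob :: "'v rel_structure \<Rightarrow> nat \<Rightarrow> 'v rel_structure set \<Rightarrow> real" where
  "accept_prob A s Rej = measure_pmf.prob (random_subset A s) {X. induced A X \<notin> Rej}"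

definition sound_at ::
    "signature \<Rightarrow> 'v rel_structure set \<Rightarrow> real \<Rightarrow> nat \<Rightarrow> 'v rel_structure set \<Rightarrow> bool" where
  "sound_at \<tau> P \<epsilon> s Rej \<longleftrightarrow> (\<forall>A\<in>structures \<tau>. s \<le> card (verts A) \<longrightarrow> eps_far \<tau> P \<epsilon> A \<longrightarrow>
     reject_prob A s Rej \<ge> 2 / 3)"

definition one_sided_tester_at ::
    "signature \<Rightarrow> 'v rel_structure set \<Rightarrow> real \<Rightarrow> nat \<Rightarrow> 'v rel_structure set \<Rightarrow> bool" where
  "one_sided_tester_at \<tau> P \<epsilon> s Rej \<longleftrightarrow> sampler \<tau> s Rej \<and> sound_at \<tau> P \<epsilon> s Rej \<and>
     (\<forall>A\<in>P. \<forall>X\<subseteq>verts A. card X = s \<longrightarrow> induced A X \<notin> Rej)"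

definition two_sided_tester_at ::
    "signature \<Rightarrow> 'v rel_structure set \<Rightarrow> real \<Rightarrow> nat \<Rightarrow> 'v rel_structure set \<Rightarrow> bool" where
  "two_sided_tester_at \<tau> P \<epsilon> s Rej \<longleftrightarrow> sampler \<tau> s Rej \<and> sound_at \<tau> P \<epsilon> s Rej \<and>
     (\<forall>A\<in>P. s \<le> card (verts A) \<longrightarrow> accept_prob A s Rej \<ge> 2 / 3)"

definition one_sided_complexity ::
    "signature \<Rightarrow> 'v rel_structure set \<Rightarrow> (real \<Rightarrow> nat) \<Rightarrow> bool" where
  "one_sided_complexity \<tau> P S \<longleftrightarrow>
     (\<forall>a b. 0 < a \<longrightarrow> a \<le> b \<longrightarrow> S b \<le> S a) \<and>
     (\<exists>Rej. \<forall>\<epsilon>>0. one_sided_tester_at \<tau> P \<epsilon> (S \<epsilon>) (Rej \<epsilon>))"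

end

theory Submission
  imports Defs "HOL-Combinatorics.Multiset_Permutations"
begin

text \<open>
  Write \<open>n\<close> for the number of vertices of the input \<open>A\<close>, \<open>k = S \<delta>\<close>, and put
  \<open>\<gamma> = \<epsilon> / (32 * \<rho>)\<close>. The tester draws \<open>s\<close> vertices and accepts if the sampled structure
  induces a member of \<open>P\<close> on at least \<open>(\<rho> - \<gamma>) * s\<close> of them. If \<open>A\<close> has a member of \<open>P\<close> on
  \<open>\<rho> * n\<close> vertices, then a sample of order \<open>1 / \<gamma>\<^sup>2\<close> sees that set in nearly the right proportion,
  by concentration of the hypergeometric distribution (\<open>hypergeometric_tail\<close>), and \<open>P\<close> is hereditary.

  Soundness has to exclude every large subset \<open>T\<close> of the sample. A union bound over all \<open>T\<close> is
  too expensive: there are exponentially many in \<open>s\<close>, and a single \<open>T\<close> escapes the one-sided tester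
  for \<open>P\<close> with probability that is only known to be exponentially small in \<open>card T / k\<close>. The proof
  uses the container method instead. Call a \<open>k\<close>-set of vertices an edge if the one-sided tester
  rejects it; a set that induces a member of \<open>P\<close> then contains no edge.

  If \<open>A\<close> is far from \<open>Large \<tau> \<rho> P\<close>, this hypergraph is dense on every set of at least
  \<open>(\<rho> - 2 * \<gamma>) * n\<close> vertices. Otherwise some set of almost \<open>\<rho> * n\<close> vertices would induce a structure
  that is \<open>\<delta>\<close>-close to a member of \<open>P\<close>; that member extends to \<open>\<rho> * n\<close> vertices, and overwriting
  \<open>A\<close> with the extension costs at most \<open>\<epsilon>\<close> (\<open>far_from_Large_induced_far\<close>); larger sets are handled
  by averaging (\<open>subset_density_average\<close>).

  In such a hypergraph each independent set \<open>I\<close> lies in a container with fewer than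
  \<open>(\<rho> - 2 * \<gamma>) * n\<close> vertices, up to rounding, which is determined by a fingerprint: a list of
  \<open>O(k * ln (2 / \<rho>))\<close> lists of fewer than \<open>k\<close> vertices of \<open>I\<close> (\<open>small_container\<close>). If the sample contains a large
  independent set, it contains a fingerprint whose container it hits in at least \<open>(\<rho> - \<gamma>) * s\<close> points,
  which is \<open>\<gamma> * s\<close> more than expected. For one fingerprint this has probability
  \<open>exp (- \<Omega>(\<gamma>\<^sup>2 * s))\<close> even given that the sample contains the fingerprint, and a sample contains only
  \<open>exp (O(k\<^sup>2 * ln (2 / \<rho>) * ln s))\<close> fingerprints (\<open>fingerprint_union_bound\<close>). Hence
  \<open>s\<close> of order \<open>k\<^sup>2 * ln (2 / \<rho>) * ln s / \<gamma>\<^sup>2\<close> suffices, which is the claimed bound.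
\<close>

section \<open>Concentration of the hypergeometric distribution\<close>

lemma card_subsets_containing:
  assumes "finite V" "J \<subseteq> V" "card J \<le> m"
  shows "card {Y. Y \<subseteq> V \<and> card Y = m \<and> J \<subseteq> Y} = (card V - card J) choose (m - card J)"
proof -
  have fJ: "finite J" using assms finite_subset by blast
  have "bij_betw (\<lambda>Y. Y - J) {Y. Y \<subseteq> V \<and> card Y = m \<and> J \<subseteq> Y}
          {Z. Z \<subseteq> V - J \<and> card Z = m - card J}"
  proof (rule bij_betw_byWitness[where f' = "\<lambda>Z. Z \<union> J"])
    show "(\<lambda>Y. Y - J) ` {Y. Y \<subseteq> V \<and> card Y = m \<and> J \<subseteq> Y} \<subseteq> {Z. Z \<subseteq> V - J \<and> card Z = m - card J}"
      using fJ by (auto simp: card_Diff_subset)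
    show "(\<lambda>Z. Z \<union> J) ` {Z. Z \<subseteq> V - J \<and> card Z = m - card J} \<subseteq> {Y. Y \<subseteq> V \<and> card Y = m \<and> J \<subseteq> Y}"
    proof safe
      fix Z assume Z: "Z \<subseteq> V - J" "card Z = m - card J"
      have "finite Z" using Z(1) assms(1) by (meson finite_Diff finite_subset)
      then have "card (Z \<union> J) = card Z + card J"
        using Z(1) fJ by (intro card_Un_disjoint) auto
      then show "card (Z \<union> J) = m" using Z assms by simp
    qed (use assms in auto)
  qed auto
  then have "card {Y. Y \<subseteq> V \<and> card Y = m \<and> J \<subseteq> Y} = card {Z. Z \<subseteq> V - J \<and> card Z = m - card J}"
    by (rule bij_betw_same_card)
  also have "\<dots> = card (V - J) choose (m - card J)"
    using assms by (intro n_subsets) auto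
  finally show ?thesis using assms fJ by (simp add: card_Diff_subset)
qed

lemma sum_Pow_power_card:
  fixes t :: real
  assumes "finite C"
  shows "(\<Sum>J\<in>Pow C. t ^ card J) = (1 + t) ^ card C"
  using prod_add[OF assms, of "\<lambda>_. t" "\<lambda>_. 1"] by (simp add: add.commute)

text \<open>
  The left side divided by \<open>N choose m\<close> is the probability that a random \<open>m\<close>-subset of an \<open>N\<close>-set
  contains \<open>j\<close> given points; each further point is included with conditional probability
  \<open>(m - i) / (N - i) \<le> m / N\<close>, as for independent sampling.
\<close>

lemma binomial_diff_le_power:
  assumes "j \<le> m" "m \<le> N" "0 < N"
  shows "real ((N - j) choose (m - j)) \<le> real (N choose m) * (real m / real N) ^ j"
  using assms(1)
proof (induction j)
  case 0
  then show ?case by simp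
next
  case (Suc j)
  let ?a = "N - Suc j" and ?b = "m - Suc j"
  have e: "N - j = Suc ?a" "m - j = Suc ?b" using Suc assms by auto
  have "Suc ?b * (Suc ?a choose Suc ?b) = Suc ?a * (?a choose ?b)"
    by (rule Suc_times_binomial)
  then have "real (m - j) * real ((N - j) choose (m - j)) = real (N - j) * real (?a choose ?b)"
    unfolding e by (metis of_nat_mult)
  then have "real (?a choose ?b) = real (m - j) / real (N - j) * real ((N - j) choose (m - j))"
    using Suc assms by (simp add: field_simps)
  also have "\<dots> \<le> real m / real N * (real (N choose m) * (real m / real N) ^ j)"
  proof (rule mult_mono)
    have "real j * real m \<le> real j * real N" using assms by (intro mult_left_mono) auto
    moreover have "real (m - j) = real m - real j" "real (N - j) = real N - real j"
      using Suc assms by auto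
    ultimately show "real (m - j) / real (N - j) \<le> real m / real N"
      using Suc assms by (simp add: divide_simps algebra_simps)
    show "real ((N - j) choose (m - j)) \<le> real (N choose m) * (real m / real N) ^ j"
      using Suc by simp
  qed auto
  finally show ?case by (simp add: mult_ac)
qed

text \<open>
  Writing \<open>exp l = 1 + t\<close>, the exponential expands over the subsets \<open>J\<close> of \<open>Y \<inter> C\<close>. Exchanging the sums leaves, for
  each \<open>J \<subseteq> C\<close>, the number of \<open>Y\<close> that contain it, which is at most what independent sampling would
  give; resumming yields the moment generating function of a binomial distribution.
\<close>

lemma hypergeometric_mgf:
  assumes V: "finite V" "card V = N" "0 < N" and C: "C \<subseteq> V" and m: "m \<le> N" and l: "0 \<le> l" "l \<le> 1"
  shows "(\<Sum>Y | Y \<subseteq> V \<and> card Y = m. exp (l * real (card (Y \<inter> C))))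
           \<le> real (N choose m) * exp ((l + l\<^sup>2) * (real m * real (card C) / real N))"
proof -
  define t where "t = exp l - 1"
  have t: "0 \<le> t" "t \<le> l + l\<^sup>2" using exp_bound[of l] l by (auto simp: t_def)
  have fC: "finite C" using V C finite_subset by blast
  let ?F = "{Y. Y \<subseteq> V \<and> card Y = m}"
  have fF: "finite ?F" using V by simp
  have "(\<Sum>Y\<in>?F. exp (l * real (card (Y \<inter> C)))) = (\<Sum>Y\<in>?F. (1 + t) ^ card (Y \<inter> C))"
    unfolding t_def by (simp add: exp_of_nat_mult[symmetric] mult.commute)
  also have "\<dots> = (\<Sum>Y\<in>?F. \<Sum>J\<in>{J. J \<in> Pow C \<and> J \<subseteq> Y}. t ^ card J)"
  proof (rule sum.cong[OF refl])
    fix Y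
    have "finite (Y \<inter> C)" using fC by simp
    then have "(1 + t) ^ card (Y \<inter> C) = (\<Sum>J\<in>Pow (Y \<inter> C). t ^ card J)"
      by (rule sum_Pow_power_card[symmetric])
    also have "Pow (Y \<inter> C) = {J. J \<in> Pow C \<and> J \<subseteq> Y}" by auto
    finally show "(1 + t) ^ card (Y \<inter> C) = (\<Sum>J\<in>{J. J \<in> Pow C \<and> J \<subseteq> Y}. t ^ card J)" .
  qed
  also have "\<dots> = (\<Sum>J\<in>Pow C. \<Sum>Y\<in>{Y. Y \<in> ?F \<and> J \<subseteq> Y}. t ^ card J)"
    using fF fC by (intro sum.swap_restrict) auto
  also have "\<dots> = (\<Sum>J\<in>Pow C. real (card {Y. Y \<subseteq> V \<and> card Y = m \<and> J \<subseteq> Y}) * t ^ card J)"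
    by (simp add: conj_assoc)
  also have "\<dots> \<le> (\<Sum>J\<in>Pow C. real (N choose m) * (real m / real N * t) ^ card J)"
  proof (rule sum_mono)
    fix J assume J: "J \<in> Pow C"
    have "real (card {Y. Y \<subseteq> V \<and> card Y = m \<and> J \<subseteq> Y}) \<le> real (N choose m) * (real m / real N) ^ card J"
    proof (cases "card J \<le> m")
      case True
      then show ?thesis
        using card_subsets_containing[of V J m] binomial_diff_le_power[of "card J" m N] J C V m by auto
    next
      case False
      have "{Y. Y \<subseteq> V \<and> card Y = m \<and> J \<subseteq> Y} = {}"
        using False V(1) by (auto dest: card_mono finite_subset)
      then show ?thesis by (metis (no_types) card.empty of_nat_0 zero_le_divide_iff of_nat_0_le_iff zero_le_mult_iff zero_le_power)
    qed
    then show "real (card {Y. Y \<subseteq> V \<and> card Y = m \<and> J \<subseteq> Y}) * t ^ card J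
        \<le> real (N choose m) * (real m / real N * t) ^ card J"
      unfolding power_mult_distrib mult.assoc[symmetric] using t(1) by (intro mult_right_mono) auto
  qed
  also have "\<dots> = real (N choose m) * (1 + real m / real N * t) ^ card C"
    by (simp add: sum_Pow_power_card[OF fC] flip: sum_distrib_left)
  also have "\<dots> \<le> real (N choose m) * exp (real m / real N * t) ^ card C"
    using t by (intro mult_left_mono power_mono) auto
  also have "\<dots> = real (N choose m) * exp (t * (real m * real (card C) / real N))"
    by (simp add: exp_of_nat_mult[symmetric] mult_ac)
  also have "\<dots> \<le> real (N choose m) * exp ((l + l\<^sup>2) * (real m * real (card C) / real N))"
    using t by (intro mult_left_mono exp_mono mult_right_mono) auto
  finally show ?thesis .
qed

text \<open>
  Markov's inequality for \<open>exp (g / 2 * card (Y \<inter> C))\<close>. The exponent \<open>g / 2\<close> minimises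
  \<open>l\<^sup>2 - g * l\<close>, which bounds the resulting exponent per sampled point when \<open>card C / N\<close> is estimated by 1
  in the quadratic term.
\<close>

lemma hypergeometric_tail:
  assumes V: "finite V" "card V = N" "0 < N" and C: "C \<subseteq> V" and m: "m \<le> N" and g: "0 \<le> g" "g \<le> 2"
    and a: "real m * real (card C) / real N + g * real m \<le> a"
  shows "real (card {Y. Y \<subseteq> V \<and> card Y = m \<and> a \<le> real (card (Y \<inter> C))})
           \<le> real (N choose m) * exp (- (real m * g\<^sup>2 / 4))"
proof -
  let ?F = "{Y. Y \<subseteq> V \<and> card Y = m}" and ?p = "real m * real (card C) / real N"
  let ?B = "{Y. Y \<subseteq> V \<and> card Y = m \<and> a \<le> real (card (Y \<inter> C))}"
  have fF: "finite ?F" using V by simp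
  have cC: "card C \<le> N" using C V card_mono by blast
  have p: "?p \<le> real m" using cC V by (simp add: divide_simps mult_left_mono)
  have "real (card ?B) * exp (g / 2 * a) = (\<Sum>Y\<in>?B. exp (g / 2 * a))" by simp
  also have "\<dots> \<le> (\<Sum>Y\<in>?B. exp (g / 2 * real (card (Y \<inter> C))))"
    using g by (intro sum_mono) (auto intro: mult_left_mono)
  also have "\<dots> \<le> (\<Sum>Y\<in>?F. exp (g / 2 * real (card (Y \<inter> C))))"
    using fF by (intro sum_mono2) auto
  also have "\<dots> \<le> real (N choose m) * exp ((g / 2 + (g / 2)\<^sup>2) * ?p)"
    using assms by (intro hypergeometric_mgf) auto
  also have "\<dots> \<le> real (N choose m) * exp (- (real m * g\<^sup>2 / 4) + g / 2 * a)"
  proof -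
    have "(g / 2 + (g / 2)\<^sup>2) * ?p + real m * g\<^sup>2 / 4 = g / 2 * ?p + (g / 2)\<^sup>2 * ?p + (g/2)\<^sup>2 * real m"
      by (simp add: power2_eq_square algebra_simps)
    also have "\<dots> \<le> g / 2 * ?p + (g / 2)\<^sup>2 * real m + (g/2)\<^sup>2 * real m"
      using p g by (intro add_mono mult_left_mono) auto
    also have "\<dots> = g / 2 * (?p + g * real m)" by (simp add: power2_eq_square algebra_simps)
    also have "\<dots> \<le> g / 2 * a" using a g by (intro mult_left_mono) auto
    finally show ?thesis by (intro mult_left_mono) auto
  qed
  also have "\<dots> = real (N choose m) * exp (- (real m * g\<^sup>2 / 4)) * exp (g / 2 * a)"
    by (simp only: exp_add mult.assoc)
  finally show ?thesis by simp
qed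

section \<open>Containers of independent sets\<close>

definition ext_count :: "'a list set \<Rightarrow> nat \<Rightarrow> 'a set \<Rightarrow> 'a list \<Rightarrow> nat" where
  "ext_count E k C W = card {xs. length xs = k - length W \<and> set xs \<subseteq> C \<and> W @ xs \<in> E}"

text \<open>
  The threshold decreases by the same amount \<open>1 / (3 * k)\<close> per vertex of \<open>W\<close>, from density 1/3 for the
  empty list to 0 for a list of full length: a rich list of length \<open>k\<close> is an edge, and
  at every earlier length the drop leaves room for the averaging argument in \<open>card_refine_le\<close>.
\<close>

definition rich :: "'a list set \<Rightarrow> nat \<Rightarrow> 'a set \<Rightarrow> 'a list \<Rightarrow> bool" where
  "rich E k C W \<longleftrightarrow>
     real (k - length W) / (3 * real k) * real (card C) ^ (k - length W) < real (ext_count E k C W)"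

text \<open>
  If \<open>W\<close> is a maximal rich list in an independent set \<open>I \<subseteq> C\<close>, then no vertex of \<open>I\<close> can extend
  \<open>W\<close> to a rich list, so \<open>I\<close> survives this step.
\<close>

definition refine :: "'a list set \<Rightarrow> nat \<Rightarrow> 'a set \<Rightarrow> 'a list \<Rightarrow> 'a set" where
  "refine E k C W = {v \<in> C. \<not> rich E k C (W @ [v])}"

definition container :: "'a list set \<Rightarrow> nat \<Rightarrow> 'a set \<Rightarrow> 'a list list \<Rightarrow> 'a set" where
  "container E k V Ws = foldl (refine E k) V Ws"

lemma refine_subset: "refine E k C W \<subseteq> C"
  by (auto simp: refine_def)

lemma container_subset: "container E k V Ws \<subseteq> V"
  unfolding container_def
proof (induction Ws rule: rev_induct)
  case (snoc W Ws)
  then show ?case using refine_subset by fastforce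
qed simp

lemma ext_count_le:
  assumes "finite C"
  shows "ext_count E k C W \<le> card C ^ (k - length W)"
proof -
  have "ext_count E k C W \<le> card {xs. set xs \<subseteq> C \<and> length xs = k - length W}"
    unfolding ext_count_def using assms by (intro card_mono finite_lists_length_eq) auto
  then show ?thesis using card_lists_length_eq[OF assms, of "k - length W"] by simp
qed

lemma ext_count_sum:
  assumes "finite C" "length W < k"
  shows "ext_count E k C W = (\<Sum>v\<in>C. ext_count E k C (W @ [v]))"
proof -
  let ?S = "\<lambda>v. {xs. length xs = k - length (W @ [v]) \<and> set xs \<subseteq> C \<and> (W @ [v]) @ xs \<in> E}"
  have fin: "finite (?S v)" for v
    by (rule finite_subset[OF _ finite_lists_length_eq[OF assms(1), of "k - length (W @ [v])"]]) auto
  have "{xs. length xs = k - length W \<and> set xs \<subseteq> C \<and> W @ xs \<in> E} = (\<Union>v\<in>C. (#) v ` ?S v)"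
  proof (rule set_eqI)
    fix xs
    obtain j where j: "k - length W = Suc j" "k - Suc (length W) = j"
      using assms(2) by (metis Suc_diff_Suc)
    show "xs \<in> {xs. length xs = k - length W \<and> set xs \<subseteq> C \<and> W @ xs \<in> E}
            \<longleftrightarrow> xs \<in> (\<Union>v\<in>C. (#) v ` ?S v)"
      by (cases xs) (auto simp: j)
  qed
  then have "ext_count E k C W = card (\<Union>v\<in>C. (#) v ` ?S v)"
    by (simp add: ext_count_def)
  also have "\<dots> = (\<Sum>v\<in>C. card ((#) v ` ?S v))"
    using assms(1) fin by (intro card_UN_disjoint) auto
  also have "\<dots> = (\<Sum>v\<in>C. ext_count E k C (W @ [v]))"
    unfolding ext_count_def by (intro sum.cong refl card_image) auto
  finally show ?thesis .
qed

text \<open>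
  The density of completions of \<open>W\<close> is the average over \<open>v \<in> C\<close> of that of \<open>W @ [v]\<close>. For a
  vertex that is kept this density is at most the threshold of \<open>W\<close> minus \<open>1 / (3 * k)\<close>, and for any
  vertex it is at most 1, so more than a fraction \<open>1 / (3 * k)\<close> of a nonempty \<open>C\<close> is removed.
\<close>

lemma card_refine_le:
  assumes C: "finite C" and W: "length W < k" and rich: "rich E k C W"
  shows "real (card (refine E k C W)) \<le> (1 - 1 / (3 * real k)) * real (card C)"
proof (cases "C = {}")
  case True
  then show ?thesis by (simp add: refine_def)
next
  case False
  define c where "c = real (card C)"
  define r where "r = real (card (refine E k C W))"
  obtain j where j: "k - length W = Suc j" "k - Suc (length W) = j"
    using W by (metis Suc_diff_Suc)
  have c: "c > 0" using False C by (simp add: c_def card_gt_0_iff)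
  let ?D = "refine E k C W"
  have "real (ext_count E k C W) = (\<Sum>v\<in>C. real (ext_count E k C (W @ [v])))"
    by (simp add: ext_count_sum[OF C W])
  also have "\<dots> = (\<Sum>v\<in>?D. real (ext_count E k C (W @ [v])))
      + (\<Sum>v\<in>C - ?D. real (ext_count E k C (W @ [v])))"
    using C refine_subset[of E k C W] by (simp add: sum.subset_diff add.commute)
  also have "\<dots> \<le> (\<Sum>v\<in>?D. real j / (3 * real k) * c ^ j) + (\<Sum>v\<in>C - ?D. c ^ j)"
  proof (intro add_mono sum_mono)
    fix v assume "v \<in> ?D"
    then show "real (ext_count E k C (W @ [v])) \<le> real j / (3 * real k) * c ^ j"
      by (simp add: refine_def rich_def j c_def)
  next
    fix v
    show "real (ext_count E k C (W @ [v])) \<le> c ^ j"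
      using ext_count_le[OF C, of E k "W @ [v]"] by (simp add: j c_def flip: of_nat_power)
  qed
  also have "\<dots> = r * (real j / (3 * real k)) * c ^ j + (c - r) * c ^ j"
    using card_mono[OF C refine_subset[of E k C W]]
    by (simp add: r_def c_def card_Diff_subset[OF finite_subset[OF refine_subset C] refine_subset])
  also have "\<dots> \<le> c * (real j / (3 * real k)) * c ^ j + (c - r) * c ^ j"
    using card_mono[OF C refine_subset[of E k C W]] c
    by (intro add_mono mult_right_mono) (auto simp: r_def c_def)
  finally have "real (Suc j) / (3 * real k) * (c * c ^ j)
      < c * (real j / (3 * real k)) * c ^ j + (c - r) * c ^ j"
    using rich by (simp add: rich_def j c_def)
  then have "(real (Suc j) / (3 * real k) * c) * c ^ j < (c * (real j / (3 * real k)) + (c - r)) * c ^ j"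
    by (simp add: algebra_simps)
  then have "real (Suc j) / (3 * real k) * c < c * (real j / (3 * real k)) + (c - r)"
    using c mult_less_cancel_right_pos[of "c ^ j"] by (metis zero_less_power)
  then have "r < (1 - 1 / (3 * real k)) * c"
    by (simp add: algebra_simps add_divide_distrib)
  then show ?thesis by (simp add: r_def c_def)
qed

text \<open>
  Take a longest rich list over \<open>I\<close>. It is shorter than \<open>k\<close>, because a rich list of length \<open>k\<close> is
  itself an edge.
\<close>

lemma shrinking_fingerprint:
  assumes I: "I \<subseteq> C" "\<And>W. W \<in> E \<Longrightarrow> \<not> set W \<subseteq> I" and rich: "rich E k C []"
  obtains W where "length W < k" "set W \<subseteq> I" "rich E k C W" "I \<subseteq> refine E k C W"
proof -
  \<comment> \<open>The empty list is rich by assumption, so a longest rich list exists.\<close>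
  let ?Q = "\<lambda>W. length W \<le> k \<and> set W \<subseteq> I \<and> rich E k C W"
  obtain W where W: "?Q W" and mx: "\<And>W'. ?Q W' \<Longrightarrow> length W' \<le> length W"
    using ex_has_greatest_nat[of ?Q "[]" length "Suc k"] rich by (auto simp: less_Suc_eq_le)
  have "length W < k"
  proof (rule ccontr)
    assume "\<not> length W < k"
    then have l: "length W = k" using W by auto
    have "W \<notin> E" using I W by blast
    then have "{xs. xs = [] \<and> set xs \<subseteq> C \<and> W @ xs \<in> E} = {}" by auto
    then have "ext_count E k C W = 0" by (simp add: ext_count_def l)
    then show False using W by (simp add: rich_def l)
  qed
  moreover have "I \<subseteq> refine E k C W"
  proof
    fix v assume v: "v \<in> I"
    have "\<not> ?Q (W @ [v])" using mx[of "W @ [v]"] by auto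
    then have "\<not> rich E k C (W @ [v])" using W v \<open>length W < k\<close> by auto
    then show "v \<in> refine E k C W" using v I by (auto simp: refine_def)
  qed
  ultimately show thesis using that W by blast
qed

text \<open>
  As long as the current candidate set has at least \<open>M\<close> vertices it is rich, so
  \<open>shrinking_fingerprint\<close> supplies a list over \<open>I\<close> that shrinks it by the factor \<open>1 - 1 / (3 * k)\<close>. The
  container depends on \<open>Ws\<close> but not on \<open>I\<close>, which is what allows a union bound over \<open>Ws\<close>.
\<close>

theorem small_container:
  assumes V: "finite V" and I: "I \<subseteq> V" "\<And>W. W \<in> E \<Longrightarrow> \<not> set W \<subseteq> I"
    and rich: "\<And>C. C \<subseteq> V \<Longrightarrow> M \<le> card C \<Longrightarrow> rich E k C []"
    and R: "real (card V) * (1 - 1 / (3 * real k)) ^ R < real M"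
  shows "\<exists>Ws. length Ws \<le> R \<and> (\<forall>W\<in>set Ws. length W < k \<and> set W \<subseteq> I) \<and>
    I \<subseteq> container E k V Ws \<and> card (container E k V Ws) < M"
proof -
  let ?\<beta> = "1 - 1 / (3 * real k)"
  have "\<exists>Ws. length Ws \<le> r \<and> (\<forall>W\<in>set Ws. length W < k \<and> set W \<subseteq> I) \<and> I \<subseteq> container E k V Ws \<and>
      (card (container E k V Ws) < M \<or> real (card (container E k V Ws)) \<le> real (card V) * ?\<beta> ^ r)" for r
  proof (induction r)
    case 0
    then show ?case using I by (intro exI[of _ "[]"]) (auto simp: container_def)
  next
    case (Suc r)
    then obtain Ws where Ws: "length Ws \<le> r" "\<forall>W\<in>set Ws. length W < k \<and> set W \<subseteq> I"
        "I \<subseteq> container E k V Ws"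
        and c: "card (container E k V Ws) < M \<or> real (card (container E k V Ws)) \<le> real (card V) * ?\<beta> ^ r"
      by blast
    let ?C = "container E k V Ws"
    show ?case
    proof (cases "card ?C < M")
      case True
      then show ?thesis using Ws by (intro exI[of _ Ws]) auto
    next
      case False
      have fC: "finite ?C" using V container_subset finite_subset by metis
      have "rich E k ?C []" using False by (intro rich container_subset) auto
      then obtain W where W: "length W < k" "set W \<subseteq> I" "rich E k ?C W" "I \<subseteq> refine E k ?C W"
        using shrinking_fingerprint[OF Ws(3) I(2)] by blast
      have k: "1 \<le> real k" using W(1) by linarith
      then have "0 \<le> ?\<beta>" by (simp add: field_simps)
      have "real (card (refine E k ?C W)) \<le> ?\<beta> * real (card ?C)"
        by (rule card_refine_le[OF fC W(1,3)])
      also have "\<dots> \<le> ?\<beta> * (real (card V) * ?\<beta> ^ r)"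
        using c False \<open>0 \<le> ?\<beta>\<close> by (intro mult_left_mono) auto
      finally have "real (card (refine E k ?C W)) \<le> real (card V) * ?\<beta> ^ Suc r" by (simp add: mult_ac)
      moreover have "container E k V (Ws @ [W]) = refine E k ?C W" by (simp add: container_def)
      ultimately show ?thesis using Ws W by (intro exI[of _ "Ws @ [W]"]) auto
    qed
  qed
  from this[of R] obtain Ws where Ws: "length Ws \<le> R" "\<forall>W\<in>set Ws. length W < k \<and> set W \<subseteq> I"
    "I \<subseteq> container E k V Ws"
    "card (container E k V Ws) < M \<or> real (card (container E k V Ws)) \<le> real (card V) * ?\<beta> ^ R"
    by blast
  have "card (container E k V Ws) < M" using Ws(4) R by linarith
  with Ws show ?thesis by blast
qed

section \<open>Counting the samples that meet a container too often\<close>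

definition fingerprints :: "nat \<Rightarrow> nat \<Rightarrow> 'a set \<Rightarrow> 'a list list set" where
  "fingerprints R k X = {Ws. length Ws \<le> R \<and> (\<forall>W\<in>set Ws. length W < k \<and> set W \<subseteq> X)}"

lemma sum_power_atMost_le:
  assumes "2 \<le> (b::nat)"
  shows "(\<Sum>i\<le>n. b ^ i) \<le> b ^ Suc n"
proof (induction n)
  case 0
  then show ?case using assms by simp
next
  case (Suc n)
  have "(\<Sum>i\<le>Suc n. b ^ i) \<le> 2 * b ^ Suc n" using Suc by simp
  also have "\<dots> \<le> b * b ^ Suc n" using assms by (intro mult_right_mono) auto
  finally show ?case by simp
qed

lemma card_fingerprints:
  assumes X: "finite X" "2 \<le> card X" and k: "0 < k"
  shows "finite (fingerprints R k X)" "card (fingerprints R k X) \<le> card X ^ (k * Suc R)"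
proof -
  define A where "A = {W. set W \<subseteq> X \<and> length W \<le> k - 1}"
  have fA: "finite A" unfolding A_def using X by (intro finite_lists_length_le)
  have eq: "fingerprints R k X = {Ws. set Ws \<subseteq> A \<and> length Ws \<le> R}"
    using k by (auto simp: fingerprints_def A_def subset_eq)
  show "finite (fingerprints R k X)" unfolding eq using fA by (intro finite_lists_length_le)
  have "card A = (\<Sum>i\<le>k - 1. card X ^ i)" unfolding A_def using X by (intro card_lists_length_le)
  also have "\<dots> \<le> card X ^ Suc (k - 1)" using X by (intro sum_power_atMost_le)
  finally have cA: "card A \<le> card X ^ k" using k by simp
  have "card (fingerprints R k X) = (\<Sum>i\<le>R. card A ^ i)"
    unfolding eq using fA by (intro card_lists_length_le)
  also have "\<dots> \<le> (\<Sum>i\<le>R. (card X ^ k) ^ i)" using cA by (intro sum_mono power_mono) auto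
  also have "\<dots> \<le> (card X ^ k) ^ Suc R"
  proof (rule sum_power_atMost_le)
    show "2 \<le> card X ^ k" using X k by (metis One_nat_def Suc_leI le_trans power_increasing power_one_right one_le_numeral)
  qed
  finally show "card (fingerprints R k X) \<le> card X ^ (k * Suc R)" by (simp only: power_mult)
qed

lemma card_set_concat_le:
  assumes "length Ws \<le> R" "\<forall>W\<in>set Ws. length W < k"
  shows "card (set (concat Ws)) \<le> k * R"
proof -
  have "length (concat Ws) \<le> k * length Ws" using assms(2) by (induction Ws) auto
  then show ?thesis using assms(1) card_length[of "concat Ws"] by (meson le_trans mult_le_mono2)
qed

text \<open>
  Given \<open>F \<subseteq> X\<close>, the rest of \<open>X\<close> is a uniform subset of \<open>V - F\<close>, and \<open>F\<close> itself accounts for at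
  most \<open>g * s\<close> of the points in \<open>C\<close>. One half of the margin \<open>2 * g\<close> absorbs these points, the other
  half is left for the tail bound.
\<close>

lemma pinned_hypergeometric_tail:
  assumes V: "finite V" "card V = n" and s: "0 < s" "s \<le> n" and F: "F \<subseteq> V" "real (card F) \<le> g * real s"
    and C: "C \<subseteq> V" "real (card C) \<le> p * real n" and g: "0 \<le> g" "g \<le> 1 / 2" and p: "0 \<le> p"
    and a: "(p + 2 * g) * real s \<le> a"
  shows "real (card {X. X \<subseteq> V \<and> card X = s \<and> F \<subseteq> X \<and> a \<le> real (card (X \<inter> C))})
    \<le> real (card {X. X \<subseteq> V \<and> card X = s \<and> F \<subseteq> X}) * exp (- (real s * g\<^sup>2 / 8))"
proof -
  define f where "f = card F"
  have fF: "finite F" using F V finite_subset by blast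
  have "g * real s \<le> 1 / 2 * real s" using g by (intro mult_right_mono) auto
  then have f: "real f \<le> real s / 2" using F by (simp add: f_def)
  then have fs: "f \<le> s" "f < n" using s by linarith+
  let ?m = "s - f" and ?N = "n - f"
  let ?B = "{X. X \<subseteq> V \<and> card X = s \<and> F \<subseteq> X \<and> a \<le> real (card (X \<inter> C))}"
  let ?T = "{Y. Y \<subseteq> V - F \<and> card Y = ?m \<and> a - real f \<le> real (card (Y \<inter> (C - F)))}"
  have "card ?B \<le> card ?T"
  proof (rule card_inj_on_le[where f = "\<lambda>X. X - F"])
    show "inj_on (\<lambda>X. X - F) ?B" by (rule inj_onI) blast
    show "finite ?T" using V by simp
    show "(\<lambda>X. X - F) ` ?B \<subseteq> ?T"
    proof safe
      fix X assume X: "X \<subseteq> V" "s = card X" "F \<subseteq> X" "a \<le> real (card (X \<inter> C))"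
      show "card (X - F) = card X - f" using X fF by (simp add: card_Diff_subset f_def)
      have fX: "finite X" using X V finite_subset by blast
      have "card (X \<inter> C) \<le> card (((X - F) \<inter> (C - F)) \<union> F)"
        using fX fF by (intro card_mono) auto
      also have "\<dots> \<le> card ((X - F) \<inter> (C - F)) + f" unfolding f_def by (rule card_Un_le)
      finally show "a - real f \<le> real (card ((X - F) \<inter> (C - F)))" using X(4) by linarith
    qed auto
  qed
  also have "real (card ?T) \<le> real (?N choose ?m) * exp (- (real ?m * g\<^sup>2 / 4))"
  proof (rule hypergeometric_tail)
    show "finite (V - F)" "card (V - F) = ?N" "0 < ?N" "C - F \<subseteq> V - F" "?m \<le> ?N" "0 \<le> g" "g \<le> 2"
      using V F fF fs s C g by (auto simp: f_def card_Diff_subset)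
    have "real (card (C - F)) \<le> real (card C)"
      using C V by (auto intro!: card_mono intro: finite_subset)
    then have cC: "real (card (C - F)) \<le> p * real n" using C by linarith
    have "real ?m * real (card (C - F)) \<le> real ?m * (p * real n)"
      using cC by (intro mult_left_mono) auto
    also have "\<dots> = p * (real ?m * real n)" by (simp add: mult_ac)
    also have "\<dots> \<le> p * (real s * real ?N)"
    proof (rule mult_left_mono)
      have "real f * real s \<le> real f * real n" using s by (intro mult_left_mono) auto
      then show "real ?m * real n \<le> real s * real ?N" using fs by (simp add: of_nat_diff algebra_simps)
    qed (use p in auto)
    finally have "real ?m * real (card (C - F)) / real ?N \<le> p * real s"
      using fs by (simp add: divide_simps mult_ac)
    moreover have "g * real ?m \<le> g * real s" using g by (intro mult_left_mono) auto
    ultimately show "real ?m * real (card (C - F)) / real ?N + g * real ?m \<le> a - real f"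
      using a F by (simp add: f_def algebra_simps)
  qed
  also have "\<dots> \<le> real (?N choose ?m) * exp (- (real s * g\<^sup>2 / 8))"
  proof -
    have "real s / 2 * g\<^sup>2 \<le> real ?m * g\<^sup>2"
      using f fs by (intro mult_right_mono) (auto simp: of_nat_diff)
    then show ?thesis by (intro mult_left_mono) auto
  qed
  also have "real (?N choose ?m) = real (card {X. X \<subseteq> V \<and> card X = s \<and> F \<subseteq> X})"
    using card_subsets_containing[of V F s] V F fs by (simp add: f_def)
  finally show ?thesis by simp
qed

text \<open>
  Summing over all fingerprints in \<open>V\<close> would give a power of \<open>n\<close>. The fingerprint is required to lie in
  the sample, so exchanging the sums replaces their number by the number inside one sample, a power
  of \<open>s\<close>.
\<close>

lemma fingerprint_union_bound:
  fixes K :: "'a list list \<Rightarrow> 'a set"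
  assumes V: "finite V" "card V = n" and s: "2 \<le> s" "s \<le> n" and k: "0 < k"
    and K: "\<And>Ws. K Ws \<subseteq> V" and kR: "real (k * R) \<le> g * real s"
    and g: "0 \<le> g" "g \<le> 1 / 2" and p: "0 \<le> p" and a: "(p + 2 * g) * real s \<le> a"
  shows "real (card {X. X \<subseteq> V \<and> card X = s \<and>
      (\<exists>Ws\<in>fingerprints R k X. real (card (K Ws)) \<le> p * real n \<and> a \<le> real (card (X \<inter> K Ws)))})
    \<le> real (n choose s) * (real s ^ (k * Suc R) * exp (- (real s * g\<^sup>2 / 8)))"
proof -
  let ?bad = "{X. X \<subseteq> V \<and> card X = s \<and>
      (\<exists>Ws\<in>fingerprints R k X. real (card (K Ws)) \<le> p * real n \<and> a \<le> real (card (X \<inter> K Ws)))}"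
  let ?F = "\<lambda>Ws. set (concat Ws)"
  let ?\<Phi> = "fingerprints R k V"
  let ?G = "{Ws \<in> ?\<Phi>. real (card (K Ws)) \<le> p * real n}"
  let ?e = "exp (- (real s * g\<^sup>2 / 8))"
  let ?\<X> = "{X. X \<subseteq> V \<and> card X = s}"
  let ?B = "\<lambda>Ws. {X. X \<subseteq> V \<and> card X = s \<and> ?F Ws \<subseteq> X \<and> a \<le> real (card (X \<inter> K Ws))}"
  have fin: "finite ?\<Phi>" using card_fingerprints(1)[of V k R] V s k by simp
  have finX: "finite ?\<X>" using V by simp
  have "?bad \<subseteq> (\<Union>Ws\<in>?G. ?B Ws)"
    by (fastforce simp: fingerprints_def)
  then have "card ?bad \<le> card (\<Union>Ws\<in>?G. ?B Ws)"
    using V fin by (intro card_mono) auto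
  also have "\<dots> \<le> (\<Sum>Ws\<in>?G. card (?B Ws))"
    using fin by (intro card_UN_le) auto
  also have "real \<dots> \<le> (\<Sum>Ws\<in>?G. real (card {X. X \<subseteq> V \<and> card X = s \<and> ?F Ws \<subseteq> X}) * ?e)"
    unfolding of_nat_sum
  proof (rule sum_mono)
    fix Ws assume Ws: "Ws \<in> ?G"
    have "card (?F Ws) \<le> k * R" using Ws by (intro card_set_concat_le) (auto simp: fingerprints_def)
    then have "real (card (?F Ws)) \<le> g * real s" using kR by linarith
    moreover have "?F Ws \<subseteq> V" using Ws by (auto simp: fingerprints_def)
    ultimately show "real (card (?B Ws)) \<le> real (card {X. X \<subseteq> V \<and> card X = s \<and> ?F Ws \<subseteq> X}) * ?e"
      using Ws V s g p a K by (intro pinned_hypergeometric_tail[where p = p]) auto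
  qed
  also have "\<dots> \<le> (\<Sum>Ws\<in>?\<Phi>. real (card {X. X \<subseteq> V \<and> card X = s \<and> ?F Ws \<subseteq> X}) * ?e)"
    using fin by (intro sum_mono2) auto
  also have "\<dots> = ?e * (\<Sum>Ws\<in>?\<Phi>. \<Sum>X\<in>{X. X \<in> ?\<X> \<and> ?F Ws \<subseteq> X}. 1)"
    by (simp add: sum_distrib_left mult.commute conj_assoc)
  also have "(\<Sum>Ws\<in>?\<Phi>. \<Sum>X\<in>{X. X \<in> ?\<X> \<and> ?F Ws \<subseteq> X}. (1::real))
      = (\<Sum>X\<in>?\<X>. \<Sum>Ws\<in>{Ws. Ws \<in> ?\<Phi> \<and> ?F Ws \<subseteq> X}. 1)"
    by (rule sum.swap_restrict[OF fin finX])
  also have "?e * \<dots> \<le> ?e * (\<Sum>X\<in>?\<X>. real s ^ (k * Suc R))"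
  proof (intro mult_left_mono sum_mono)
    fix X assume X: "X \<in> ?\<X>"
    then have fX: "finite X" using V finite_subset by blast
    have "{Ws. Ws \<in> ?\<Phi> \<and> ?F Ws \<subseteq> X} \<subseteq> fingerprints R k X"
      by (auto simp: fingerprints_def)
    then have "card {Ws. Ws \<in> ?\<Phi> \<and> ?F Ws \<subseteq> X} \<le> card (fingerprints R k X)"
      using card_fingerprints(1)[of X k R] fX X s k by (intro card_mono) auto
    also have "\<dots> \<le> s ^ (k * Suc R)" using card_fingerprints(2)[of X k R] fX X s k by simp
    finally have "real (card {Ws. Ws \<in> ?\<Phi> \<and> ?F Ws \<subseteq> X}) \<le> real s ^ (k * Suc R)"
      by (simp only: of_nat_power[symmetric] of_nat_le_iff)
    then show "(\<Sum>Ws\<in>{Ws. Ws \<in> ?\<Phi> \<and> ?F Ws \<subseteq> X}. 1) \<le> real s ^ (k * Suc R)" by simp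
  qed auto
  also have "\<dots> = real (n choose s) * (real s ^ (k * Suc R) * ?e)"
    using n_subsets[OF V(1), of s] V by simp
  finally show ?thesis by simp
qed

section \<open>Dense hypergraphs\<close>

text \<open>
  Every \<open>k\<close>-subset of \<open>U\<close> lies in the same number of \<open>M\<close>-subsets of \<open>U\<close>, so the density on \<open>U\<close> is the
  average of the densities on its \<open>M\<close>-subsets.
\<close>

lemma subset_density_average:
  assumes U: "finite U" "M \<le> card U" and k: "k \<le> M"
    and dense: "\<And>Z. Z \<subseteq> U \<Longrightarrow> card Z = M \<Longrightarrow>
      \<alpha> * real (M choose k) \<le> real (card {Y. Y \<subseteq> Z \<and> card Y = k \<and> Y \<in> \<E>})"
  shows "\<alpha> * real (card U choose k) \<le> real (card {Y. Y \<subseteq> U \<and> card Y = k \<and> Y \<in> \<E>})"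
proof -
  let ?u = "card U"
  let ?\<Z> = "{Z. Z \<subseteq> U \<and> card Z = M}" and ?\<Y> = "{Y. Y \<subseteq> U \<and> card Y = k \<and> Y \<in> \<E>}"
  have fin: "finite ?\<Z>" "finite ?\<Y>" using U by auto
  have cZ: "card ?\<Z> = ?u choose M" using U by (intro n_subsets)
  have "real ((?u - k) choose (M - k)) * (\<alpha> * real (?u choose k)) = \<alpha> * real ((?u choose M) * (M choose k))"
    unfolding choose_mult[OF k U(2)] by simp
  also have "\<dots> = (\<Sum>Z\<in>?\<Z>. \<alpha> * real (M choose k))" by (simp add: cZ)
  also have "\<dots> \<le> (\<Sum>Z\<in>?\<Z>. real (card {Y. Y \<subseteq> Z \<and> card Y = k \<and> Y \<in> \<E>}))"
    using dense by (intro sum_mono) auto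
  also have "\<dots> = (\<Sum>Z\<in>?\<Z>. \<Sum>Y\<in>{Y. Y \<in> ?\<Y> \<and> Y \<subseteq> Z}. 1)"
  proof (rule sum.cong[OF refl])
    fix Z assume "Z \<in> ?\<Z>"
    then have "{Y. Y \<subseteq> Z \<and> card Y = k \<and> Y \<in> \<E>} = {Y. Y \<in> ?\<Y> \<and> Y \<subseteq> Z}" by auto
    then show "real (card {Y. Y \<subseteq> Z \<and> card Y = k \<and> Y \<in> \<E>}) = (\<Sum>Y\<in>{Y. Y \<in> ?\<Y> \<and> Y \<subseteq> Z}. 1)" by simp
  qed
  also have "\<dots> = (\<Sum>Y\<in>?\<Y>. \<Sum>Z\<in>{Z. Z \<in> ?\<Z> \<and> Y \<subseteq> Z}. 1)"
    by (rule sum.swap_restrict[OF fin])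
  also have "\<dots> = (\<Sum>Y\<in>?\<Y>. real ((?u - k) choose (M - k)))"
  proof (rule sum.cong[OF refl])
    fix Y assume Y: "Y \<in> ?\<Y>"
    have "{Z. Z \<in> ?\<Z> \<and> Y \<subseteq> Z} = {Z. Z \<subseteq> U \<and> card Z = M \<and> Y \<subseteq> Z}" by auto
    then show "(\<Sum>Z\<in>{Z. Z \<in> ?\<Z> \<and> Y \<subseteq> Z}. 1) = real ((?u - k) choose (M - k))"
      using card_subsets_containing[OF U(1), of Y M] Y k by simp
  qed
  finally have "real ((?u - k) choose (M - k)) * (\<alpha> * real (?u choose k))
      \<le> real ((?u - k) choose (M - k)) * real (card ?\<Y>)" by (simp add: mult.commute)
  moreover have "0 < (?u - k) choose (M - k)" using U k by (intro zero_less_binomial) auto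
  ultimately show ?thesis by (simp only: mult_le_cancel_left_pos of_nat_0_less_iff)
qed

lemma power_le_fact_binomial:
  assumes "j \<le> k" "k \<le> c"
  shows "(c - k) ^ j \<le> fact j * (c choose j)"
  using assms(1)
proof (induction j)
  case (Suc j)
  have "(c - k) ^ Suc j = (c - k) * (c - k) ^ j" by simp
  also have "\<dots> \<le> (c - j) * (fact j * (c choose j))" using Suc by (intro mult_mono) auto
  also have "\<dots> = fact j * ((c - j) * (c choose j))" by (simp add: mult_ac)
  also have "\<dots> = fact j * (Suc j * (c choose Suc j))"
    by (simp only: binomial_absorb_comp binomial_absorption)
  also have "\<dots> = fact (Suc j) * (c choose Suc j)" by (simp only: fact_Suc mult_ac of_nat_id)
  finally show ?case .
qed simp

text \<open>
  Converts densities among \<open>k\<close>-subsets into densities among lists, of which a proportion of at least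
  \<open>(1 - k / c) ^ k \<ge> 1 - k\<^sup>2 / c > 1 / 2\<close> is injective, by Bernoulli's inequality.
\<close>

lemma half_power_less_fact_binomial:
  assumes "2 * k\<^sup>2 < c"
  shows "real c ^ k / 2 < fact k * real (c choose k)"
proof -
  have kc: "k \<le> c" "0 < c" using assms by (auto simp: power2_eq_square intro: order_trans[OF le_square])
  have "1 / 2 < 1 + real k * (- (real k / real c))"
  proof -
    have "2 * (real k)\<^sup>2 < real c" using assms by (metis of_nat_less_iff of_nat_mult of_nat_numeral of_nat_power)
    then show ?thesis using kc by (simp add: field_simps power2_eq_square)
  qed
  also have "\<dots> \<le> (1 + - (real k / real c)) ^ k"
    using kc by (intro Bernoulli_inequality) auto
  finally have "real c ^ k * (1 / 2) < real c ^ k * (1 + - (real k / real c)) ^ k"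
    using kc by (intro mult_strict_left_mono) auto
  also have "\<dots> = (real c * (1 + - (real k / real c))) ^ k" by (simp add: power_mult_distrib)
  also have "real c * (1 + - (real k / real c)) = real (c - k)" using kc by (simp add: algebra_simps)
  also have "real (c - k) ^ k \<le> fact k * real (c choose k)"
    using power_le_fact_binomial[of k k c] kc
    by (metis of_nat_fact of_nat_le_iff of_nat_mult of_nat_power order_refl)
  finally show ?thesis by simp
qed

text \<open>
  Lists record the order in which a fingerprint picks the vertices of an edge.
\<close>

definition edge_lists :: "nat \<Rightarrow> 'a set set \<Rightarrow> 'a list set" where
  "edge_lists k \<E> = {xs. distinct xs \<and> length xs = k \<and> set xs \<in> \<E>}"

lemma ext_count_edge_lists:
  assumes "finite C"
  shows "ext_count (edge_lists k \<E>) k C [] = fact k * card {Y. Y \<subseteq> C \<and> card Y = k \<and> Y \<in> \<E>}"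
proof -
  let ?\<Y> = "{Y. Y \<subseteq> C \<and> card Y = k \<and> Y \<in> \<E>}"
  have fin: "finite Y" if "Y \<in> ?\<Y>" for Y using that assms finite_subset by blast
  have "{xs. length xs = k - length [] \<and> set xs \<subseteq> C \<and> [] @ xs \<in> edge_lists k \<E>}
      = (\<Union>Y\<in>?\<Y>. permutations_of_set Y)"
    by (auto simp: edge_lists_def permutations_of_set_def distinct_card)
  then have "ext_count (edge_lists k \<E>) k C [] = card (\<Union>Y\<in>?\<Y>. permutations_of_set Y)"
    by (simp add: ext_count_def)
  also have "\<dots> = (\<Sum>Y\<in>?\<Y>. card (permutations_of_set Y))"
  proof (rule card_UN_disjoint)
    show "finite ?\<Y>" using assms by simp
    show "\<forall>Y\<in>?\<Y>. finite (permutations_of_set Y)" by simp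
  qed (auto simp: permutations_of_set_def)
  also have "\<dots> = (\<Sum>Y\<in>?\<Y>. fact k)"
    using fin by (intro sum.cong) auto
  finally show ?thesis by simp
qed

lemma dense_imp_rich:
  assumes C: "finite C" "M \<le> card C" and k: "0 < k" "2 * k\<^sup>2 < M"
    and dense: "\<And>Z. Z \<subseteq> C \<Longrightarrow> card Z = M \<Longrightarrow>
      2 / 3 * real (M choose k) \<le> real (card {Y. Y \<subseteq> Z \<and> card Y = k \<and> Y \<in> \<E>})"
  shows "rich (edge_lists k \<E>) k C []"
proof -
  have kM: "k \<le> M" using k by (auto simp: power2_eq_square intro: order_trans[OF le_square])
  have "real (card C) ^ k / 3 < 2 / 3 * (fact k * real (card C choose k))"
    using half_power_less_fact_binomial[of k "card C"] k C by simp
  also have "\<dots> = fact k * (2 / 3 * real (card C choose k))" by simp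
  also have "\<dots> \<le> fact k * real (card {Y. Y \<subseteq> C \<and> card Y = k \<and> Y \<in> \<E>})"
    using subset_density_average[OF C kM dense] by (intro mult_left_mono) auto
  also have "\<dots> = real (ext_count (edge_lists k \<E>) k C [])"
    by (simp add: ext_count_edge_lists[OF C(1)])
  finally show ?thesis using k by (simp add: rich_def)
qed

text \<open>
  Combines the containers with the union bound: a large edge-free subset of \<open>X\<close> has a fingerprint
  inside \<open>X\<close> and is contained in the corresponding container, which \<open>X\<close> therefore hits too often.
  The containers have fewer than \<open>M\<close> vertices, so the hypothesis on \<open>M\<close> bounds them by \<open>p * n\<close>; it
  holds for \<open>M = \<lceil>p * n\<rceil>\<close>.
\<close>

theorem card_samples_with_large_independent_set:
  fixes \<E> :: "'a set set"
  assumes V: "finite V" "card V = n" and s: "2 \<le> s" "s \<le> n" and k: "0 < k" "2 * k\<^sup>2 < M"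
    and M: "\<And>j. j < M \<Longrightarrow> real j \<le> p * real n" and p: "0 \<le> p"
    and dense: "\<And>Z. Z \<subseteq> V \<Longrightarrow> card Z = M \<Longrightarrow>
      2 / 3 * real (M choose k) \<le> real (card {Y. Y \<subseteq> Z \<and> card Y = k \<and> Y \<in> \<E>})"
    and R: "real n * (1 - 1 / (3 * real k)) ^ R < real M"
    and g: "0 \<le> g" "g \<le> 1 / 2" and kR: "real (k * R) \<le> g * real s"
    and a: "(p + 2 * g) * real s \<le> a"
  shows "real (card {X. X \<subseteq> V \<and> card X = s \<and>
      (\<exists>T\<subseteq>X. a \<le> real (card T) \<and> (\<forall>Y\<subseteq>T. card Y = k \<longrightarrow> Y \<notin> \<E>))})
    \<le> real (n choose s) * (real s ^ (k * Suc R) * exp (- (real s * g\<^sup>2 / 8)))"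
proof -
  let ?K = "container (edge_lists k \<E>) k V"
  let ?bad = "{X. X \<subseteq> V \<and> card X = s \<and>
      (\<exists>T\<subseteq>X. a \<le> real (card T) \<and> (\<forall>Y\<subseteq>T. card Y = k \<longrightarrow> Y \<notin> \<E>))}"
  let ?cov = "{X. X \<subseteq> V \<and> card X = s \<and> (\<exists>Ws\<in>fingerprints R k X.
      real (card (?K Ws)) \<le> p * real n \<and> a \<le> real (card (X \<inter> ?K Ws)))}"
  have "?bad \<subseteq> ?cov"
  proof
    fix X assume "X \<in> ?bad"
    then obtain T where X: "X \<subseteq> V" "card X = s"
      and T: "T \<subseteq> X" "a \<le> real (card T)" "\<forall>Y\<subseteq>T. card Y = k \<longrightarrow> Y \<notin> \<E>" by blast
    have "\<exists>Ws. length Ws \<le> R \<and> (\<forall>W\<in>set Ws. length W < k \<and> set W \<subseteq> T) \<and> T \<subseteq> ?K Ws \<and> card (?K Ws) < M"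
    proof (rule small_container[OF V(1)])
      show "T \<subseteq> V" using X T by blast
      show "\<not> set W \<subseteq> T" if "W \<in> edge_lists k \<E>" for W
        using that T(3) by (auto simp: edge_lists_def distinct_card)
      show "rich (edge_lists k \<E>) k C []" if "C \<subseteq> V" "M \<le> card C" for C
        using that V dense k by (intro dense_imp_rich[where M = M]) (auto intro: finite_subset)
      show "real (card V) * (1 - 1 / (3 * real k)) ^ R < real M" using R V by simp
    qed
    then obtain Ws where Ws: "length Ws \<le> R" "\<forall>W\<in>set Ws. length W < k \<and> set W \<subseteq> T"
        "T \<subseteq> ?K Ws" "card (?K Ws) < M" by blast
    have fp: "Ws \<in> fingerprints R k X" using Ws T by (auto simp: fingerprints_def)
    have "card T \<le> card (X \<inter> ?K Ws)"
      using Ws T X V by (intro card_mono) (auto intro: finite_subset)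
    then have "a \<le> real (card (X \<inter> ?K Ws))" using T by linarith
    then show "X \<in> ?cov" using X fp M Ws by blast
  qed
  then have "card ?bad \<le> card ?cov" using V by (intro card_mono) auto
  also have "real \<dots> \<le> real (n choose s) * (real s ^ (k * Suc R) * exp (- (real s * g\<^sup>2 / 8)))"
    using assms by (intro fingerprint_union_bound) (auto simp: container_subset)
  finally show ?thesis by simp
qed

section \<open>Relational structures\<close>

definition relabel :: "('v \<Rightarrow> 'v) \<Rightarrow> 'v rel_structure \<Rightarrow> 'v rel_structure" where
  "relabel f A = \<lparr>verts = f ` verts A, rels = map (\<lambda>R. map f ` R) (rels A)\<rparr>"

lemma induced_simps [simp]:
  "verts (induced A U) = U"
  "length (rels (induced A U)) = length (rels A)"
  "i < length (rels A) \<Longrightarrow> rels (induced A U) ! i = {t \<in> rels A ! i. set t \<subseteq> U}"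
  by (auto simp: induced_def)

lemma induced_induced: "Y \<subseteq> X \<Longrightarrow> induced (induced A X) Y = induced A Y"
  by (auto simp: induced_def intro!: map_cong)

lemma structures_rels_subset:
  "A \<in> structures \<tau> \<Longrightarrow> i < length \<tau> \<Longrightarrow> t \<in> rels A ! i \<Longrightarrow> length t = \<tau> ! i \<and> set t \<subseteq> verts A"
  by (auto simp: structures_def)

lemma induced_in_structures: "A \<in> structures \<tau> \<Longrightarrow> U \<subseteq> verts A \<Longrightarrow> induced A U \<in> structures \<tau>"
  by (auto simp: structures_def finite_subset)

lemma relabel_in_structures:
  "A \<in> structures \<tau> \<Longrightarrow> relabel f A \<in> structures \<tau>"
  by (fastforce simp: structures_def relabel_def)

lemma isomorphic_relabel: "inj_on f (verts A) \<Longrightarrow> isomorphic A (relabel f A)"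
  by (auto simp: isomorphic_def relabel_def bij_betw_def)

lemma isomorphicE:
  assumes "isomorphic A B"
  obtains f where "inj_on f (verts A)" "B = relabel f A"
  using assms by (auto simp: isomorphic_def relabel_def bij_betw_def)

lemma induced_relabel:
  assumes A: "A \<in> structures \<tau>" and f: "inj_on f (verts A)" and U: "U \<subseteq> verts A"
  shows "induced (relabel f A) (f ` U) = relabel f (induced A U)"
proof -
  have "{t \<in> map f ` R. set t \<subseteq> f ` U} = map f ` {t \<in> R. set t \<subseteq> U}" if "R \<in> set (rels A)" for R
  proof -
    have R: "set t \<subseteq> verts A" if "t \<in> R" for t
      using \<open>R \<in> set (rels A)\<close> that A by (auto simp: in_set_conv_nth structures_def)
    have eq: "(set (map f t) \<subseteq> f ` U) = (set t \<subseteq> U)" if "t \<in> R" for t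
      using inj_on_image_subset_iff[OF f R[OF that] U] by simp
    show ?thesis
    proof (intro equalityI subsetI)
      fix u assume "u \<in> {t \<in> map f ` R. set t \<subseteq> f ` U}"
      then obtain t where "t \<in> R" "u = map f t" "set (map f t) \<subseteq> f ` U" by blast
      then show "u \<in> map f ` {t \<in> R. set t \<subseteq> U}" using eq by blast
    next
      fix u assume "u \<in> map f ` {t \<in> R. set t \<subseteq> U}"
      then obtain t where "t \<in> R" "u = map f t" "set t \<subseteq> U" by blast
      then show "u \<in> {t \<in> map f ` R. set t \<subseteq> f ` U}" using eq by blast
    qed
  qed
  then show ?thesis by (auto simp: induced_def relabel_def)
qed

lemma relabel_inverse:
  assumes A: "A \<in> structures \<tau>" and f: "inj_on f (verts A)"
  shows "relabel (inv_into (verts A) f) (relabel f A) = A"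
proof -
  have "map (inv_into (verts A) f) ` map f ` R = R" if "R \<in> set (rels A)" for R
  proof -
    have R: "set t \<subseteq> verts A" if "t \<in> R" for t
      using \<open>R \<in> set (rels A)\<close> that A by (auto simp: in_set_conv_nth structures_def)
    have "map (inv_into (verts A) f) (map f t) = t" if "t \<in> R" for t
      using R[OF that] f by (auto simp: map_idI subset_iff)
    then show ?thesis by (force simp: image_image)
  qed
  then show ?thesis
    using f by (auto simp: relabel_def image_image map_idI intro!: rel_structure.equality)
qed

lemma isomorphic_sym:
  assumes "A \<in> structures \<tau>" "isomorphic A B"
  shows "isomorphic B A"
proof -
  obtain f where f: "inj_on f (verts A)" "B = relabel f A" using assms(2) by (rule isomorphicE)
  have "inj_on (inv_into (verts A) f) (verts B)" using f by (simp add: relabel_def inj_on_inv_into)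
  then have "isomorphic B (relabel (inv_into (verts A) f) B)" by (rule isomorphic_relabel)
  then show ?thesis using relabel_inverse[OF assms(1) f(1)] f(2) by simp
qed

text \<open>
  Extendability gives no control over which new vertices appear; closure under isomorphism moves them into \<open>V\<close> while fixing the vertices of \<open>B\<close>.
\<close>

lemma property_extension_within:
  assumes P: "is_property \<tau> P" "extendable P" and B: "B \<in> P" "verts B \<subseteq> V" and V: "finite V"
    and K: "card (verts B) \<le> K" "K \<le> card V"
  shows "\<exists>B'\<in>P. verts B' \<subseteq> V \<and> verts B \<subseteq> verts B' \<and> card (verts B') = K \<and> induced B' (verts B) = B"
proof -
  let ?U = "verts B"
  obtain D where D: "D \<in> P" "card (verts D) = K" "?U \<subseteq> verts D" "induced D ?U = B"
  proof -
    have "\<exists>D\<in>P. card (verts D) = card ?U + (K - card ?U) \<and> ?U \<subseteq> verts D \<and> induced D ?U = B"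
      using P(2) B(1) unfolding extendable_def by blast
    then show ?thesis using that K by auto
  qed
  have Ds: "D \<in> structures \<tau>" using D P by (auto simp: is_property_def)
  then have fD: "finite (verts D)" by (auto simp: structures_def)
  obtain W where W: "?U \<subseteq> W" "W \<subseteq> V" "card W = K"
    using exists_subset_between[of ?U K V] K B V by blast
  have fW: "finite W" using W V finite_subset by blast
  have "card (verts D - ?U) = card (W - ?U)"
    using D W fD fW by (simp add: card_Diff_subset finite_subset)
  then obtain g where g: "bij_betw g (verts D - ?U) (W - ?U)"
    using fD fW by (metis finite_Diff finite_same_card_bij)
  define f where "f = (\<lambda>x. if x \<in> ?U then x else g x)"
  have "bij_betw f (?U \<union> (verts D - ?U)) (?U \<union> (W - ?U))"
  proof (rule bij_betw_combine)
    show "bij_betw f ?U ?U" by (auto simp: f_def bij_betw_def inj_on_def)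
    show "bij_betw f (verts D - ?U) (W - ?U)"
      using g by (rule iffD1[OF bij_betw_cong, rotated]) (auto simp: f_def)
  qed auto
  then have f: "bij_betw f (verts D) W" using D W by (simp add: Un_absorb1)
  let ?B' = "relabel f D"
  have "isomorphic D ?B'" using f by (intro isomorphic_relabel) (auto simp: bij_betw_def)
  then have "?B' \<in> P" using P(1) D(1) relabel_in_structures[OF Ds] by (auto simp: is_property_def)
  moreover have v: "verts ?B' = W" using f by (auto simp: relabel_def bij_betw_def)
  moreover have "induced ?B' ?U = B"
  proof -
    have "f ` ?U = ?U" by (auto simp: f_def)
    then have "induced ?B' ?U = relabel f (induced D ?U)"
      using induced_relabel[OF Ds, of f ?U] f D by (simp add: bij_betw_def)
    also have "\<dots> = relabel f B" by (simp add: D)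
    also have "\<dots> = B"
    proof -
      have "map f ` R = R" if "R \<in> set (rels B)" for R
      proof -
        have "B \<in> structures \<tau>" using P B by (auto simp: is_property_def)
        then have "set t \<subseteq> ?U" if "t \<in> R" for t
          using \<open>R \<in> set (rels B)\<close> that by (auto simp: in_set_conv_nth structures_def)
        then have "map f t = t" if "t \<in> R" for t using that by (auto simp: f_def map_idI subset_iff)
        then show ?thesis by force
      qed
      then show ?thesis
        using \<open>f ` ?U = ?U\<close> by (auto simp: relabel_def map_idI intro!: rel_structure.equality)
    qed
    finally show ?thesis .
  qed
  ultimately show ?thesis using W by blast
qed

definition transplant :: "'v rel_structure \<Rightarrow> 'v rel_structure \<Rightarrow> 'v rel_structure" where
  "transplant A B = \<lparr>verts = verts A,
     rels = map2 (\<lambda>R Q. {t \<in> R. \<not> set t \<subseteq> verts B} \<union> Q) (rels A) (rels B)\<rparr>"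

lemma transplant_in_structures:
  assumes "A \<in> structures \<tau>" "B \<in> structures \<tau>" "verts B \<subseteq> verts A"
  shows "transplant A B \<in> structures \<tau>"
proof -
  have len: "length (rels A) = length \<tau>" "length (rels B) = length \<tau>"
    using assms by (auto simp: structures_def)
  have "rels (transplant A B) ! i \<subseteq> {t. length t = \<tau> ! i \<and> set t \<subseteq> verts A}" if i: "i < length \<tau>" for i
    using i len structures_rels_subset[OF assms(1) i] structures_rels_subset[OF assms(2) i] assms(3)
    by (auto simp: transplant_def)
  then show ?thesis
    using assms(1) len by (simp add: structures_def transplant_def)
qed

lemma induced_transplant:
  assumes "A \<in> structures \<tau>" "B \<in> structures \<tau>"
  shows "induced (transplant A B) (verts B) = B"
proof (rule rel_structure.equality)
  have len: "length (rels A) = length \<tau>" "length (rels B) = length \<tau>"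
    using assms by (auto simp: structures_def)
  show "rels (induced (transplant A B) (verts B)) = rels B"
  proof (rule nth_equalityI)
    show "length (rels (induced (transplant A B) (verts B))) = length (rels B)"
      using len by (simp add: transplant_def)
    fix i assume "i < length (rels (induced (transplant A B) (verts B)))"
    then have i: "i < length \<tau>" using len by (simp add: transplant_def)
    show "rels (induced (transplant A B) (verts B)) ! i = rels B ! i"
      using i len structures_rels_subset[OF assms(2) i] by (auto simp: transplant_def)
  qed
qed auto

lemma card_pairs_not_inside:
  assumes "finite W" "U \<subseteq> W"
  shows "finite {t. length t = 2 \<and> set t \<subseteq> W \<and> \<not> set t \<subseteq> U}"
    "real (card {t. length t = 2 \<and> set t \<subseteq> W \<and> \<not> set t \<subseteq> U}) = (real (card W))\<^sup>2 - (real (card U))\<^sup>2"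
proof -
  let ?L = "\<lambda>Z. {t. set t \<subseteq> Z \<and> length t = 2}"
  have fU: "finite U" using assms finite_subset by blast
  have eq: "{t. length t = 2 \<and> set t \<subseteq> W \<and> \<not> set t \<subseteq> U} = ?L W - ?L U" by auto
  show "finite {t. length t = 2 \<and> set t \<subseteq> W \<and> \<not> set t \<subseteq> U}"
    unfolding eq using finite_lists_length_eq[OF assms(1)] by blast
  have "card (?L W - ?L U) = card (?L W) - card (?L U)"
    using assms finite_lists_length_eq[OF fU] by (intro card_Diff_subset) auto
  also have "\<dots> = (card W)\<^sup>2 - (card U)\<^sup>2"
    by (simp only: card_lists_length_eq[OF assms(1)] card_lists_length_eq[OF fU])
  finally show "real (card {t. length t = 2 \<and> set t \<subseteq> W \<and> \<not> set t \<subseteq> U}) = (real (card W))\<^sup>2 - (real (card U))\<^sup>2"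
    unfolding eq using assms by (simp add: of_nat_diff card_mono power_mono)
qed

text \<open>
  \<open>A\<close> and the transplant differ only on pairs inside \<open>verts B\<close>. Pairs inside \<open>U\<close> are accounted for
  by the distance on \<open>U\<close>, rescaled from \<open>card U\<close> to all vertices; every other pair is
  counted as changed.
\<close>

lemma struct_dist_transplant_le:
  assumes ar: "\<forall>a\<in>set \<tau>. a = 2" and A: "A \<in> structures \<tau>" and B: "B \<in> structures \<tau>"
    and U: "U \<subseteq> verts B" "verts B \<subseteq> verts A"
  shows "struct_dist \<tau> A (transplant A B)
    \<le> struct_dist \<tau> (induced A U) (induced B U) * (real (card U) / real (card (verts A)))\<^sup>2
      + ((real (card (verts B)))\<^sup>2 - (real (card U))\<^sup>2) / (real (card (verts A)))\<^sup>2"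
proof -
  let ?W = "verts B"
  define n where "n = real (card (verts A))"
  define u where "u = real (card U)"
  define w where "w = real (card ?W)"
  have fin: "finite (verts A)" "finite ?W" "finite U"
    using A B U by (auto simp: structures_def finite_subset)
  have len: "length (rels A) = length \<tau>" "length (rels B) = length \<tau>"
    using A B by (auto simp: structures_def)
  have uw: "u \<le> w" using fin U by (auto simp: u_def w_def card_mono)
  define d where "d i = real (card ((rels A ! i - rels (transplant A B) ! i) \<union> (rels (transplant A B) ! i - rels A ! i)))" for i
  define e where "e i = real (card ((rels (induced A U) ! i - rels (induced B U) ! i)
      \<union> (rels (induced B U) ! i - rels (induced A U) ! i)))" for i
  have two: "\<tau> ! i = 2" if "i < length \<tau>" for i using ar that by simp
  have de: "d i \<le> e i + (w\<^sup>2 - u\<^sup>2)" if i: "i < length \<tau>" for i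
  proof -
    let ?X = "(rels (induced A U) ! i - rels (induced B U) ! i) \<union> (rels (induced B U) ! i - rels (induced A U) ! i)"
    let ?Y = "{t. length t = 2 \<and> set t \<subseteq> ?W \<and> \<not> set t \<subseteq> U}"
    have l: "length t = 2" if "t \<in> rels A ! i" for t
      using structures_rels_subset[OF A i that] two[OF i] by simp
    have lB: "length t = 2" "set t \<subseteq> ?W" if "t \<in> rels B ! i" for t
      using structures_rels_subset[OF B i that] two[OF i] by auto
    have sp: "rels (transplant A B) ! i = {t \<in> rels A ! i. \<not> set t \<subseteq> ?W} \<union> rels B ! i"
      using i len by (simp add: transplant_def)
    have "(rels A ! i - rels (transplant A B) ! i) \<union> (rels (transplant A B) ! i - rels A ! i) \<subseteq> ?X \<union> ?Y"
      using i len l lB unfolding sp by (auto split: if_splits)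
    moreover have "finite ?X"
    proof -
      have "?X \<subseteq> {t. set t \<subseteq> U \<and> length t = 2}" using i len l lB by auto
      then show ?thesis using finite_lists_length_eq[OF fin(3)] finite_subset by blast
    qed
    ultimately have "card ((rels A ! i - rels (transplant A B) ! i) \<union> (rels (transplant A B) ! i - rels A ! i)) \<le> card (?X \<union> ?Y)"
      using card_pairs_not_inside(1)[OF fin(2) U(1)] by (intro card_mono) auto
    also have "\<dots> \<le> card ?X + card ?Y" by (rule card_Un_le)
    finally have "d i \<le> real (card ?X) + real (card ?Y)" unfolding d_def by linarith
    then show ?thesis unfolding e_def w_def u_def card_pairs_not_inside(2)[OF fin(2) U(1)] .
  qed
  \<comment> \<open>For \<open>U = {}\<close> the quotient \<open>e i / u\<^sup>2\<close> has the default value 0, which is correct as no pair lies in \<open>U\<close>.\<close>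
  have e0: "u = 0 \<Longrightarrow> i < length \<tau> \<Longrightarrow> e i = 0" for i
  proof -
    assume "u = 0" and i: "i < length \<tau>"
    then have "U = {}" using fin by (simp add: u_def)
    have "[] \<notin> rels A ! i" "[] \<notin> rels B ! i"
      using structures_rels_subset[OF A i] structures_rels_subset[OF B i] two[OF i] by force+
    then show "e i = 0" using i len \<open>U = {}\<close> by (auto simp: e_def)
  qed
  have "struct_dist \<tau> A (transplant A B) = 1 / real (length \<tau>) * (\<Sum>i<length \<tau>. d i / n\<^sup>2)"
    unfolding struct_dist_def d_def n_def
    by (intro arg_cong2[where f = "(*)"] refl sum.cong) (simp add: two)
  also have "\<dots> \<le> 1 / real (length \<tau>) * (\<Sum>i<length \<tau>. e i / u\<^sup>2 * (u / n)\<^sup>2 + (w\<^sup>2 - u\<^sup>2) / n\<^sup>2)"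
  proof (intro mult_left_mono sum_mono)
    fix i assume i: "i \<in> {..<length \<tau>}"
    then have "d i / n\<^sup>2 \<le> (e i + (w\<^sup>2 - u\<^sup>2)) / n\<^sup>2" using de[of i] by (intro divide_right_mono) auto
    also have "\<dots> = e i / u\<^sup>2 * (u / n)\<^sup>2 + (w\<^sup>2 - u\<^sup>2) / n\<^sup>2"
      using e0[of i] i by (cases "u = 0") (auto simp: add_divide_distrib diff_divide_distrib power_divide)
    finally show "d i / n\<^sup>2 \<le> e i / u\<^sup>2 * (u / n)\<^sup>2 + (w\<^sup>2 - u\<^sup>2) / n\<^sup>2" .
  qed auto
  also have "\<dots> = (1 / real (length \<tau>) * (\<Sum>i<length \<tau>. e i / u\<^sup>2)) * (u / n)\<^sup>2
      + real (length \<tau>) / real (length \<tau>) * ((w\<^sup>2 - u\<^sup>2) / n\<^sup>2)"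
    by (simp only: sum.distrib flip: sum_distrib_right) (simp add: distrib_left)
  \<comment> \<open>For the empty signature the quotient \<open>length \<tau> / length \<tau>\<close> is 0 rather than 1.\<close>
  also have "\<dots> \<le> (1 / real (length \<tau>) * (\<Sum>i<length \<tau>. e i / u\<^sup>2)) * (u / n)\<^sup>2 + 1 * ((w\<^sup>2 - u\<^sup>2) / n\<^sup>2)"
    using uw by (intro add_left_mono mult_right_mono) (auto simp: u_def power_mono)
  also have "1 / real (length \<tau>) * (\<Sum>i<length \<tau>. e i / u\<^sup>2) = struct_dist \<tau> (induced A U) (induced B U)"
    unfolding struct_dist_def e_def u_def
    by (intro arg_cong2[where f = "(*)"] refl sum.cong) (simp_all add: two)
  finally show ?thesis by (simp add: n_def u_def w_def)
qed

text \<open>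
  A member of \<open>P\<close> within \<open>\<delta>\<close> of \<open>induced A U\<close> could be extended to \<open>K \<ge> \<rho> * n\<close> vertices and
  transplanted into \<open>A\<close>; the result belongs to \<open>Large \<tau> \<rho> P\<close> at distance at most \<open>\<epsilon>\<close>.
\<close>

theorem far_from_Large_induced_far:
  assumes ar: "\<forall>a\<in>set \<tau>. a = 2" and P: "is_property \<tau> P" "extendable P" and A: "A \<in> structures \<tau>"
    and far: "eps_far \<tau> (Large \<tau> \<rho> P) \<epsilon> A" and U: "U \<subseteq> verts A" "card U \<le> K"
    and K: "K \<le> card (verts A)" "\<rho> * real (card (verts A)) \<le> real K"
    and cost: "\<delta> * (real (card U) / real (card (verts A)))\<^sup>2
      + ((real K)\<^sup>2 - (real (card U))\<^sup>2) / (real (card (verts A)))\<^sup>2 \<le> \<epsilon>"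
  shows "eps_far \<tau> P \<delta> (induced A U)"
  unfolding eps_far_def
proof (intro ballI impI)
  fix B assume B: "B \<in> P" "verts B = verts (induced A U)"
  have vB: "verts B = U" using B by simp
  have fV: "finite (verts A)" using A by (simp add: structures_def)
  obtain D where D: "D \<in> P" "verts D \<subseteq> verts A" "U \<subseteq> verts D" "card (verts D) = K" "induced D U = B"
    using property_extension_within[OF P B(1) _ fV, of K] vB U K by auto
  have Ds: "D \<in> structures \<tau>" using D P by (auto simp: is_property_def)
  have "transplant A D \<in> Large \<tau> \<rho> P"
    unfolding Large_def using transplant_in_structures[OF A Ds D(2)] induced_transplant[OF A Ds] D K
    by (auto simp: transplant_def intro!: exI[of _ "verts D"])
  then have "\<epsilon> < struct_dist \<tau> A (transplant A D)"
    using far by (auto simp: eps_far_def transplant_def)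
  also have "\<dots> \<le> struct_dist \<tau> (induced A U) B * (real (card U) / real (card (verts A)))\<^sup>2
      + ((real K)\<^sup>2 - (real (card U))\<^sup>2) / (real (card (verts A)))\<^sup>2"
    using struct_dist_transplant_le[OF ar A Ds D(3) D(2)] D by simp
  finally have "\<delta> * (real (card U) / real (card (verts A)))\<^sup>2
      < struct_dist \<tau> (induced A U) B * (real (card U) / real (card (verts A)))\<^sup>2"
    using cost by linarith
  then show "\<delta> < struct_dist \<tau> (induced A U) B"
    by (metis mult_less_cancel_right zero_le_power2 not_less)
qed

section \<open>Choice of the parameters\<close>

text \<open>
  \<open>R\<close> is the number of rounds after which \<open>(1 - 1 / (3 * k)) ^ R \<le> \<rho> / 2\<close>. Containers have at
  most \<open>p * n\<close> vertices, so that the acceptance threshold \<open>\<rho> - \<gamma>\<close> lies midway between \<open>p\<close> and \<open>\<rho>\<close>;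
  \<open>M n\<close> and \<open>K n\<close> are the sizes, before and after extension, of the sets used for transplanting.
\<close>

locale tester_params =
  fixes k :: nat and \<rho> \<epsilon> :: real
  assumes k: "0 < k" and \<rho>: "0 < \<rho>" "\<rho> \<le> 1" and \<epsilon>: "0 < \<epsilon>" "\<epsilon> \<le> \<rho>\<^sup>2 / 8"
begin

definition X where "X = \<rho>\<^sup>2 / \<epsilon>\<^sup>2 * (real k)\<^sup>2 * ln (2 / \<rho>)"
definition s where "s = nat \<lceil>2 ^ 21 * X * ln X\<rceil>"
definition R where "R = nat \<lceil>3 * real k * ln (2 / \<rho>)\<rceil>"
definition \<gamma> where "\<gamma> = \<epsilon> / (32 * \<rho>)"

definition r where "r = \<rho> / \<epsilon>"
definition Q where "Q = (real k)\<^sup>2 * ln (2 / \<rho>)"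

lemma r_ge: "8 \<le> \<rho> * r" "8 \<le> r"
proof -
  show "8 \<le> \<rho> * r" using \<rho> \<epsilon> by (simp add: r_def field_simps power2_eq_square)
  also have "\<dots> \<le> 1 * r" using \<rho> \<epsilon> by (intro mult_right_mono) (auto simp: r_def)
  finally show "8 \<le> r" by simp
qed

lemma L_ge: "2 / 3 \<le> ln (2 / \<rho>)"
proof -
  have "2 / 3 \<le> ln (2 :: real)" by (rule ln2_ge_two_thirds)
  also have "\<dots> \<le> ln (2 / \<rho>)" using \<rho> by (intro ln_mono) (auto simp: field_simps)
  finally show ?thesis .
qed

lemma k_sq_ge: "1 \<le> (real k)\<^sup>2" using k by simp

lemma Q_ge: "2 / 3 * (real k)\<^sup>2 \<le> Q" "2 / 3 \<le> Q"
proof -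
  show "2 / 3 * (real k)\<^sup>2 \<le> Q"
    using mult_left_mono[OF L_ge, of "(real k)\<^sup>2"] by (simp add: Q_def mult.commute)
  then show "2 / 3 \<le> Q" using k_sq_ge by linarith
qed

lemma X_eq: "X = r\<^sup>2 * Q"
  by (simp add: X_def r_def Q_def power_divide mult.assoc)

lemma X_ge_rQ: "8 * (r * Q) \<le> X"
proof -
  have "8 * (r * Q) \<le> r * (r * Q)" using r_ge Q_ge by (intro mult_right_mono) auto
  then show ?thesis by (simp add: X_eq power2_eq_square mult.assoc)
qed

lemma rQ_ge: "r * (2 / 3) \<le> r * Q" "8 * Q \<le> r * Q"
  using r_ge Q_ge by (auto intro!: mult_left_mono mult_right_mono)

lemma X_ge: "32 \<le> X" "1 \<le> ln X"
proof -
  show X: "32 \<le> X" using X_ge_rQ rQ_ge r_ge by linarith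
  have "exp 1 \<le> X" using X exp_le by linarith
  then show "1 \<le> ln X" using X by (subst ln_ge_iff) auto
qed

lemma s_bounds:
  "2 ^ 21 * X * ln X \<le> real s" "2 ^ 21 * X \<le> real s" "real s \<le> 2 ^ 22 * X * ln X" "2 \<le> s"
proof -
  have p: "1 * 1 \<le> X * ln X" using X_ge by (intro mult_mono) auto
  show a: "2 ^ 21 * X * ln X \<le> real s" unfolding s_def by linarith
  have "2 ^ 21 * X * 1 \<le> 2 ^ 21 * X * ln X" using X_ge by (intro mult_left_mono) auto
  then show "2 ^ 21 * X \<le> real s" using a by linarith
  then have "real 2 \<le> real s" using X_ge by simp
  then show "2 \<le> s" by (simp only: of_nat_le_iff)
  have "real s \<le> 2 ^ 21 * X * ln X + 1" unfolding s_def using X_ge by (simp add: of_nat_nat)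
  then show "real s \<le> 2 ^ 22 * X * ln X" using p by simp
qed

text \<open>
  Removes the circularity between the sample size and the factor \<open>ln s\<close> in the union bound: \<open>s\<close> is polynomial in \<open>X\<close>.
\<close>

lemma ln_s_le: "ln (real s) \<le> 7 * ln X"
proof -
  have "real s \<le> 2 ^ 22 * X * ln X" by (rule s_bounds)
  also have "\<dots> \<le> X ^ 5 * X * X"
  proof (intro mult_mono)
    have "(2::real) ^ 22 \<le> 32 ^ 5" by simp
    also have "\<dots> \<le> X ^ 5" using X_ge by (intro power_mono) auto
    finally show "2 ^ 22 \<le> X ^ 5" .
    show "ln X \<le> X" using ln_le_minus_one[of X] X_ge by linarith
  qed (use X_ge in auto)
  also have "\<dots> = X ^ 7" by (simp add: power_numeral_reduce)
  finally have "ln (real s) \<le> ln (X ^ 7)" using s_bounds(4) X_ge by (intro ln_mono) auto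
  then show ?thesis using X_ge by (simp add: ln_realpow)
qed

lemma R_bounds: "3 * real k * ln (2 / \<rho>) \<le> real R" "real (k * Suc R) \<le> 6 * Q"
proof -
  show "3 * real k * ln (2 / \<rho>) \<le> real R" unfolding R_def by linarith
  have kL: "1 * (2 / 3) \<le> real k * ln (2 / \<rho>)" using k L_ge by (intro mult_mono) auto
  have "real R \<le> 3 * real k * ln (2 / \<rho>) + 1" unfolding R_def using kL by (simp add: of_nat_nat)
  then have "real (Suc R) \<le> 6 * (real k * ln (2 / \<rho>))" using kL by simp
  then have "real k * real (Suc R) \<le> real k * (6 * (real k * ln (2 / \<rho>)))" by (intro mult_left_mono) auto
  then show "real (k * Suc R) \<le> 6 * Q"
    unfolding of_nat_mult Q_def power2_eq_square by (simp only: mult_ac)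
qed

lemma \<gamma>_bounds: "0 < \<gamma>" "\<gamma> \<le> \<rho> / 256" "\<gamma> = 1 / (32 * r)" "\<gamma> \<le> 1"
proof -
  show "0 < \<gamma>" "\<gamma> = 1 / (32 * r)" using \<rho> \<epsilon> by (auto simp: \<gamma>_def r_def)
  show "\<gamma> \<le> \<rho> / 256" using \<rho> \<epsilon> by (simp add: \<gamma>_def field_simps power2_eq_square)
  then show "\<gamma> \<le> 1" using \<rho> by linarith
qed

lemma fingerprint_small: "real (k * R) \<le> \<gamma> / 2 * real s"
proof -
  have "real (k * R) \<le> real (k * Suc R)" by (subst of_nat_le_iff) simp
  also have "\<dots> \<le> 6 * Q" by (rule R_bounds)
  also have "\<dots> \<le> 8 * (r * Q)" using rQ_ge Q_ge by linarith
  also have "\<dots> \<le> 2 ^ 15 * (r * Q)" using rQ_ge Q_ge by simp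
  also have "\<dots> = \<gamma> / 2 * (2 ^ 21 * X)"
    unfolding \<gamma>_bounds(3) X_eq using r_ge by (simp add: power2_eq_square)
  also have "\<dots> \<le> \<gamma> / 2 * real s" using s_bounds(2) \<gamma>_bounds(1) by (intro mult_left_mono) auto
  finally show ?thesis .
qed

text \<open>
  The constant \<open>2 ^ 21\<close> in the sample size is chosen for this: \<open>\<gamma>\<^sup>2 * s / 32\<close>, the exponent of the tail
  bound, is at least \<open>64 * Q * ln X\<close> and beats the exponent \<open>42 * Q * ln X\<close> of the number of
  fingerprints.
\<close>

lemma \<gamma>_sq_s: "2 ^ 11 * (Q * ln X) \<le> real s * \<gamma>\<^sup>2"
proof -
  have "2 ^ 11 * (Q * ln X) = (2 ^ 21 * X * ln X) * \<gamma>\<^sup>2"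
    unfolding \<gamma>_bounds(3) X_eq using r_ge by (simp add: power_divide power_mult_distrib)
  also have "\<dots> \<le> real s * \<gamma>\<^sup>2" using s_bounds(1) by (intro mult_right_mono) auto
  finally show ?thesis .
qed

lemma exp_le_third: "x \<le> - 2 \<Longrightarrow> exp x \<le> 1 / (3::real)"
proof -
  assume "x \<le> -2"
  then have "exp x \<le> exp (- 2)" by simp
  also have "\<dots> = 1 / exp 2" by (simp add: exp_minus field_simps)
  also have "\<dots> \<le> 1 / 3" using exp_ge_add_one_self[of 2] by (intro divide_left_mono) auto
  finally show ?thesis .
qed

lemma QlnX_ge: "2 / 3 \<le> Q * ln X"
  using mult_mono[of "2/3" Q 1 "ln X"] Q_ge X_ge by auto

lemma completeness_error: "exp (- (real s * \<gamma>\<^sup>2 / 4)) \<le> 1 / 3"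
  using \<gamma>_sq_s QlnX_ge by (intro exp_le_third) simp

lemma soundness_error: "real s ^ (k * Suc R) * exp (- (real s * (\<gamma> / 2)\<^sup>2 / 8)) \<le> 1 / 3"
proof -
  have "real s ^ (k * Suc R) = exp (real (k * Suc R) * ln (real s))"
    using s_bounds(4) by (subst exp_of_nat_mult) simp
  also have "\<dots> \<le> exp (6 * Q * (7 * ln X))"
    using R_bounds(2) ln_s_le s_bounds(4) Q_ge by (intro exp_mono mult_mono) auto
  finally have "real s ^ (k * Suc R) * exp (- (real s * (\<gamma> / 2)\<^sup>2 / 8))
      \<le> exp (6 * Q * (7 * ln X)) * exp (- (real s * (\<gamma> / 2)\<^sup>2 / 8))"
    by (intro mult_right_mono) auto
  also have "\<dots> = exp (42 * (Q * ln X) - real s * \<gamma>\<^sup>2 / 32)"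
    by (simp add: exp_add[symmetric] power_divide algebra_simps)
  also have "\<dots> \<le> 1 / 3"
    using \<gamma>_sq_s QlnX_ge by (intro exp_le_third) simp
  finally show ?thesis .
qed

definition p where "p = \<rho> - 2 * \<gamma>"
definition M where "M n = nat \<lceil>p * real n\<rceil>"
definition K where "K n = nat \<lceil>\<rho> * real n\<rceil>"

lemma p_bounds: "\<rho> / 2 < p" "0 \<le> p"
  using \<gamma>_bounds(1,2) \<rho> by (auto simp: p_def)

context
  fixes n :: nat
  assumes n: "s \<le> n"
begin

lemma n_ge: "2 ^ 21 * X \<le> real n" "2 ^ 24 * (r * Q) \<le> real n" "2 ^ 23 * r \<le> real n" "0 < real n"
proof -
  show 1: "2 ^ 21 * X \<le> real n" using s_bounds(2) n by linarith
  then show 2: "2 ^ 24 * (r * Q) \<le> real n" using X_ge_rQ by simp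
  have "2 ^ 23 * r \<le> 2 ^ 24 * (r * (2 / 3))" using r_ge by simp
  also have "\<dots> \<le> 2 ^ 24 * (r * Q)" by (rule mult_left_mono[OF rQ_ge(1)]) simp
  finally show "2 ^ 23 * r \<le> real n" using 2 by linarith
  moreover have "0 < 2 ^ 23 * r" using r_ge by simp
  ultimately show "0 < real n" by (rule less_le_trans[rotated])
qed

lemma M_bounds: "p * real n \<le> real (M n)" "real (M n) \<le> p * real n + 1" "j < M n \<Longrightarrow> real j \<le> p * real n"
proof -
  have p0: "0 \<le> p * real n" using p_bounds by simp
  show "p * real n \<le> real (M n)" unfolding M_def by linarith
  show 1: "real (M n) \<le> p * real n + 1" unfolding M_def using p0 by (simp add: of_nat_nat)
  assume "j < M n"
  then have "real j \<le> real (M n) - 1" by linarith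
  then show "real j \<le> p * real n" using 1 by linarith
qed

lemma K_bounds: "\<rho> * real n \<le> real (K n)" "real (K n) \<le> \<rho> * real n + 1" "K n \<le> n"
proof -
  have p0: "0 \<le> \<rho> * real n" using \<rho> by simp
  show "\<rho> * real n \<le> real (K n)" unfolding K_def by linarith
  show 1: "real (K n) \<le> \<rho> * real n + 1" unfolding K_def using p0 by (simp add: of_nat_nat)
  have "\<rho> * real n \<le> real n" using \<rho> by (simp add: mult_left_le_one_le)
  then show "K n \<le> n" unfolding K_def by (simp add: nat_le_iff ceiling_le_iff)
qed

lemma \<gamma>n_ge: "1 \<le> \<gamma> * real n"
proof -
  have "32 * r \<le> 2 ^ 23 * r" using r_ge by simp
  then have "32 * r \<le> real n" using n_ge(3) by linarith
  then show ?thesis unfolding \<gamma>_bounds(3) using r_ge by (simp add: field_simps)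
qed

lemma M_le: "real (M n) \<le> \<rho> * real n" "M n \<le> K n"
proof -
  show 1: "real (M n) \<le> \<rho> * real n" using M_bounds(2) \<gamma>n_ge by (simp add: p_def algebra_simps)
  then show "M n \<le> K n" using K_bounds(1) by linarith
qed

lemma M_large: "2 * k\<^sup>2 < M n"
proof -
  have "2 * (real k)\<^sup>2 < 2 ^ 20 * (8 * (2 / 3 * (real k)\<^sup>2))" using k by simp
  also have "\<dots> \<le> 2 ^ 20 * (8 * Q)" using Q_ge(1) by simp
  also have "\<dots> \<le> 2 ^ 20 * ((\<rho> * r) * (r * Q))"
  proof -
    have "8 * Q \<le> r * Q" by (rule rQ_ge)
    also have "1 * (r * Q) \<le> (\<rho> * r) * (r * Q)" using r_ge rQ_ge Q_ge by (intro mult_right_mono) auto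
    finally show ?thesis by (intro mult_left_mono) auto
  qed
  also have "\<dots> = \<rho> / 2 * (2 ^ 21 * X)" by (simp add: X_eq power2_eq_square)
  also have "\<dots> \<le> p * real n" using n_ge(1) p_bounds \<rho> X_ge by (intro mult_mono) auto
  also have "\<dots> \<le> real (M n)" by (rule M_bounds)
  finally have "real (2 * k\<^sup>2) < real (M n)" by simp
  then show ?thesis by (simp only: of_nat_less_iff)
qed

text \<open>
  \<open>R\<close> rounds shrink the vertex set by the factor \<open>\<rho> / 2\<close>, and \<open>\<rho> / 2 < p\<close>.
\<close>

lemma rounds_suffice: "real n * (1 - 1 / (3 * real k)) ^ R < real (M n)"
proof -
  have "1 - 1 / (3 * real k) \<le> exp (- (1 / (3 * real k)))"
    using exp_ge_add_one_self[of "- (1 / (3 * real k))"] by simp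
  moreover have "0 \<le> 1 - 1 / (3 * real k)" using k by (simp add: field_simps)
  ultimately have "(1 - 1 / (3 * real k)) ^ R \<le> exp (- (1 / (3 * real k))) ^ R"
    by (intro power_mono) auto
  also have "\<dots> = exp (- (real R / (3 * real k)))" by (simp add: exp_of_nat_mult[symmetric])
  also have "\<dots> \<le> exp (- ln (2 / \<rho>))" using R_bounds(1) k by (simp add: field_simps)
  also have "\<dots> = \<rho> / 2" using \<rho> by (simp add: exp_minus)
  finally have "real n * (1 - 1 / (3 * real k)) ^ R \<le> real n * (\<rho> / 2)" by (intro mult_left_mono) auto
  also have "\<dots> < real n * p" using p_bounds n_ge by (intro mult_strict_left_mono) auto
  also have "\<dots> \<le> real (M n)" using M_bounds by (simp add: mult.commute)
  finally show ?thesis .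
qed

text \<open>
  The rescaled distance inside the \<open>M\<close>-set contributes at most \<open>\<delta> * \<rho>\<^sup>2 = \<epsilon> / 4\<close>. There are
  \<open>(K - M) * (K + M) \<le> (2 * \<gamma> * n + 1) * (3 * \<rho> * n)\<close> pairs outside it. The choice of \<open>\<gamma>\<close> turns the main
  term into \<open>6 * \<epsilon> * n\<^sup>2 / 32\<close>, and the summand 1, which comes from rounding, costs at most
  \<open>3 * \<epsilon> * n\<^sup>2 / 8\<close> because \<open>n\<close> is large.
\<close>

lemma transplant_cost:
  "\<epsilon> / (4 * \<rho>\<^sup>2) * (real (M n) / real n)\<^sup>2 + ((real (K n))\<^sup>2 - (real (M n))\<^sup>2) / (real n)\<^sup>2 \<le> \<epsilon>"
proof -
  have n0: "0 < real n" by (rule n_ge)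
  have "8 * r \<le> 2 ^ 23 * r" using r_ge by simp
  then have rn: "8 * r \<le> real n" using n_ge(3) by linarith
  have "(real (M n) / real n)\<^sup>2 \<le> \<rho>\<^sup>2" using M_le n0 by (intro power_mono) (auto simp: field_simps)
  then have 1: "\<epsilon> / (4 * \<rho>\<^sup>2) * (real (M n) / real n)\<^sup>2 \<le> \<epsilon> / (4 * \<rho>\<^sup>2) * \<rho>\<^sup>2"
    using \<epsilon> by (intro mult_left_mono) auto
  also have "\<dots> = \<epsilon> / 4" using \<rho> by simp
  finally have 1: "\<epsilon> / (4 * \<rho>\<^sup>2) * (real (M n) / real n)\<^sup>2 \<le> \<epsilon> / 4" .
  have "\<gamma> * real n \<le> \<rho> * real n" using \<gamma>_bounds(2) \<rho> by (intro mult_right_mono) auto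
  then have "1 \<le> \<rho> * real n" using \<gamma>n_ge by linarith
  then have "real (K n) + real (M n) \<le> 3 * \<rho> * real n" using K_bounds(2) M_le by linarith
  moreover have "real (K n) - real (M n) \<le> 2 * \<gamma> * real n + 1"
    using K_bounds(2) M_bounds(1) by (simp add: p_def algebra_simps)
  ultimately have "(real (K n) - real (M n)) * (real (K n) + real (M n)) \<le> (2 * \<gamma> * real n + 1) * (3 * \<rho> * real n)"
    using M_le by (intro mult_mono) (use \<gamma>n_ge in auto)
  then have "((real (K n))\<^sup>2 - (real (M n))\<^sup>2) / (real n)\<^sup>2 \<le> (2 * \<gamma> * real n + 1) * (3 * \<rho> * real n) / (real n)\<^sup>2"
    by (intro divide_right_mono) (auto simp: power2_eq_square algebra_simps)
  also have "\<dots> = 6 * (\<gamma> * \<rho>) + 3 * (\<rho> / real n)"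
    using n0 by (simp add: field_simps power2_eq_square)
  also have "\<gamma> * \<rho> = \<epsilon> / 32" using \<rho> by (simp add: \<gamma>_def)
  also have "\<rho> / real n \<le> \<epsilon> / 8" using rn n0 \<epsilon> by (simp add: r_def field_simps)
  finally show ?thesis using 1 \<epsilon> by linarith
qed

end

end

section \<open>The tester\<close>

lemma prob_random_subset:
  assumes "finite (verts A)" "s \<le> card (verts A)"
  shows "measure_pmf.prob (random_subset A s) B
    = real (card {X. X \<subseteq> verts A \<and> card X = s \<and> X \<in> B}) / real (card (verts A) choose s)"
proof -
  let ?S = "{X. X \<subseteq> verts A \<and> card X = s}"
  have c: "card ?S = card (verts A) choose s" using assms by (intro n_subsets)
  then have "card ?S > 0" using assms by (simp add: zero_less_binomial)
  then have "?S \<noteq> {}" "finite ?S" by (auto simp: card_gt_0_iff)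
  moreover have "?S \<inter> B = {X. X \<subseteq> verts A \<and> card X = s \<and> X \<in> B}" by auto
  ultimately show ?thesis unfolding random_subset_def using c by (simp add: measure_pmf_of_set)
qed

lemma prob_random_subset_ge:
  assumes A: "finite (verts A)" "s \<le> card (verts A)"
    and bad: "real (card {X. X \<subseteq> verts A \<and> card X = s \<and> X \<notin> B}) \<le> real (card (verts A) choose s) * q"
  shows "1 - q \<le> measure_pmf.prob (random_subset A s) B"
proof -
  have pos: "0 < real (card (verts A) choose s)" using A by (simp add: zero_less_binomial)
  have "measure_pmf.prob (random_subset A s) (- B) \<le> q"
    unfolding prob_random_subset[OF A] using bad pos by (simp add: field_simps)
  then show ?thesis
    using measure_pmf.prob_compl[of B "random_subset A s"] by (simp add: Compl_eq_Diff_UNIV)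
qed

text \<open>
  The tester rejects exactly these isomorphism types.
\<close>

definition sparse_types :: "signature \<Rightarrow> nat \<Rightarrow> real \<Rightarrow> 'v rel_structure set \<Rightarrow> 'v rel_structure set" where
  "sparse_types \<tau> s a P = {F \<in> structures \<tau>. card (verts F) = s \<and>
     \<not> (\<exists>T\<subseteq>verts F. a \<le> real (card T) \<and> induced F T \<in> P)}"

lemma sampler_sparse_types:
  assumes P: "is_property \<tau> P" and s: "0 < s"
  shows "sampler \<tau> s (sparse_types \<tau> s a P)"
proof -
  have "B \<in> sparse_types \<tau> s a P"
    if F: "F \<in> sparse_types \<tau> s a P" and B: "B \<in> structures \<tau>" "isomorphic F B" for F B
  proof -
    have Fs: "F \<in> structures \<tau>" using F by (simp add: sparse_types_def)
    obtain f where f: "inj_on f (verts F)" "B = relabel f F" using B(2) by (rule isomorphicE)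
    have vB: "verts B = f ` verts F" using f by (simp add: relabel_def)
    have "False" if T: "T \<subseteq> verts B" "a \<le> real (card T)" "induced B T \<in> P" for T
    proof -
      obtain U where U: "U \<subseteq> verts F" "T = f ` U" using T(1) vB by (auto simp: subset_image_iff)
      have fU: "inj_on f U" using f(1) U(1) inj_on_subset by blast
      have Us: "induced F U \<in> structures \<tau>" using Fs U by (intro induced_in_structures)
      have "induced B T = relabel f (induced F U)" using induced_relabel[OF Fs f(1) U(1)] f U by simp
      then have "isomorphic (induced F U) (induced B T)" using fU by (simp add: isomorphic_relabel)
      then have "induced F U \<in> P"
        using isomorphic_sym[OF Us] P T(3) Us unfolding is_property_def by blast
      moreover have "card U = card T" using fU U by (simp add: card_image)
      ultimately show False using F U T by (auto simp: sparse_types_def)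
    qed
    moreover have "card (verts B) = s" using F f vB by (simp add: sparse_types_def card_image)
    ultimately show ?thesis using B by (auto simp: sparse_types_def)
  qed
  moreover have "F \<in> structures \<tau>" "card (verts F) = s" if "F \<in> sparse_types \<tau> s a P" for F
    using that by (simp_all add: sparse_types_def)
  ultimately show ?thesis using s unfolding sampler_def is_property_def by blast
qed

lemma induced_in_sparse_types_iff:
  assumes "A \<in> structures \<tau>" "X \<subseteq> verts A" "card X = s"
  shows "induced A X \<in> sparse_types \<tau> s a P \<longleftrightarrow> \<not> (\<exists>T\<subseteq>X. a \<le> real (card T) \<and> induced A T \<in> P)"
proof -
  have "induced A X \<in> structures \<tau>" using assms(1,2) by (rule induced_in_structures)
  moreover have "induced (induced A X) T = induced A T" if "T \<subseteq> X" for T using that by (rule induced_induced)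
  ultimately show ?thesis using assms(3) unfolding sparse_types_def by auto
qed

text \<open>
  The sample contains too few points of the witness \<open>U\<close> only if it contains too many points of the
  complement of \<open>U\<close>, which the upper tail bound makes unlikely.
\<close>

lemma sparse_types_accepts_Large:
  assumes her: "hereditary P" and A: "A \<in> Large \<tau> \<rho> P" and s: "0 < s" "s \<le> card (verts A)"
    and g: "0 \<le> g" "g \<le> 1"
  shows "1 - exp (- (real s * g\<^sup>2 / 4)) \<le> accept_prob A s (sparse_types \<tau> s ((\<rho> - g) * real s) P)"
proof -
  obtain U where U: "U \<subseteq> verts A" "\<rho> * real (card (verts A)) \<le> real (card U)" "induced A U \<in> P"
    and As: "A \<in> structures \<tau>" using A by (auto simp: Large_def)
  have fin: "finite (verts A)" using As by (simp add: structures_def)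
  define n where "n = card (verts A)"
  define C where "C = verts A - U"
  have n0: "0 < n" using s by (simp add: n_def)
  have cC: "real (card C) \<le> (1 - \<rho>) * real n"
  proof -
    have "card C = n - card U" "card U \<le> n"
      using U fin by (auto simp: C_def n_def card_Diff_subset finite_subset card_mono)
    then show ?thesis using U(2) by (simp add: n_def of_nat_diff algebra_simps)
  qed
  let ?bad = "{X. X \<subseteq> verts A \<and> card X = s \<and> X \<notin> {X. induced A X \<notin> sparse_types \<tau> s ((\<rho> - g) * real s) P}}"
  have "?bad \<subseteq> {X. X \<subseteq> verts A \<and> card X = s \<and> (1 - \<rho> + g) * real s \<le> real (card (X \<inter> C))}"
  proof
    fix X assume "X \<in> ?bad"
    then have X: "X \<subseteq> verts A" "card X = s" and "induced A X \<in> sparse_types \<tau> s ((\<rho> - g) * real s) P" by auto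
    then have nT: "\<not> ((\<rho> - g) * real s \<le> real (card T))" if "T \<subseteq> X" "induced A T \<in> P" for T
      using that induced_in_sparse_types_iff[OF As X] by blast
    have "induced A (X \<inter> U) \<in> P"
    proof -
      have "induced (induced A U) (X \<inter> U) \<in> P" using her U(3) unfolding hereditary_def by simp
      then show ?thesis by (simp add: induced_induced)
    qed
    then have "real (card (X \<inter> U)) < (\<rho> - g) * real s" using nT[of "X \<inter> U"] by (simp add: not_le)
    moreover have "card X = card (X \<inter> U) + card (X \<inter> C)"
    proof -
      have "finite X" using X fin finite_subset by blast
      moreover have "X = (X \<inter> U) \<union> (X \<inter> C)" using X by (auto simp: C_def)
      ultimately show ?thesis by (subst card_Un_disjoint[symmetric]) (auto simp: C_def)
    qed
    ultimately show "X \<in> {X. X \<subseteq> verts A \<and> card X = s \<and> (1 - \<rho> + g) * real s \<le> real (card (X \<inter> C))}"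
      using X by (simp add: algebra_simps)
  qed
  then have "real (card ?bad) \<le> real (card {X. X \<subseteq> verts A \<and> card X = s \<and> (1 - \<rho> + g) * real s \<le> real (card (X \<inter> C))})"
    using fin by (intro of_nat_mono card_mono) auto
  also have "\<dots> \<le> real (n choose s) * exp (- (real s * g\<^sup>2 / 4))"
  proof (rule hypergeometric_tail[OF fin n_def[symmetric] n0])
    show "C \<subseteq> verts A" "s \<le> n" "0 \<le> g" "g \<le> 2" using s g by (auto simp: C_def n_def)
    have "real s * real (card C) \<le> real s * ((1 - \<rho>) * real n)" using cC by (intro mult_left_mono) auto
    then have "real s * real (card C) / real n \<le> (1 - \<rho>) * real s" using n0 by (simp add: field_simps)
    then show "real s * real (card C) / real n + g * real s \<le> (1 - \<rho> + g) * real s" by (simp add: algebra_simps)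
  qed
  finally show ?thesis
    unfolding accept_prob_def n_def by (intro prob_random_subset_ge[OF fin s(2)]) auto
qed

lemma one_sided_reject_density:
  assumes tst: "one_sided_tester_at \<tau> P \<delta> k Rej" and A: "A \<in> structures \<tau>" and Z: "Z \<subseteq> verts A" "k \<le> card Z"
    and far: "eps_far \<tau> P \<delta> (induced A Z)"
  shows "2 / 3 * real (card Z choose k) \<le> real (card {Y. Y \<subseteq> Z \<and> card Y = k \<and> Y \<in> {Y. induced A Y \<in> Rej}})"
proof -
  have fin: "finite (verts (induced A Z))" using A Z by (auto simp: structures_def finite_subset)
  have "2 / 3 \<le> reject_prob (induced A Z) k Rej"
    using tst far Z induced_in_structures[OF A Z(1)] unfolding one_sided_tester_at_def sound_at_def by simp
  also have "\<dots> = real (card {Y. Y \<subseteq> Z \<and> card Y = k \<and> induced (induced A Z) Y \<in> Rej}) / real (card Z choose k)"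
    unfolding reject_prob_def using Z(2) fin by (subst prob_random_subset) auto
  also have "{Y. Y \<subseteq> Z \<and> card Y = k \<and> induced (induced A Z) Y \<in> Rej}
      = {Y. Y \<subseteq> Z \<and> card Y = k \<and> Y \<in> {Y. induced A Y \<in> Rej}}"
    by (auto simp: induced_induced)
  finally show ?thesis using Z(2) by (simp add: pos_le_divide_eq zero_less_binomial)
qed

context tester_params
begin

text \<open>
  By one-sidedness, a set that induces a member of \<open>P\<close> is edge-free in the hypergraph of rejected
  \<open>k\<close>-sets; hence an accepted sample contains a large edge-free set.
\<close>

lemma sparse_types_rejects_far:
  assumes ar: "\<forall>a\<in>set \<tau>. a = 2" and P: "is_property \<tau> P" "extendable P"
    and tst: "one_sided_tester_at \<tau> P (\<epsilon> / (4 * \<rho>\<^sup>2)) k Rej"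
    and A: "A \<in> structures \<tau>" "s \<le> card (verts A)" "eps_far \<tau> (Large \<tau> \<rho> P) \<epsilon> A"
  shows "2 / 3 \<le> reject_prob A s (sparse_types \<tau> s ((\<rho> - \<gamma>) * real s) P)"
proof -
  define n where "n = card (verts A)"
  let ?V = "verts A" and ?\<E> = "{Y. induced A Y \<in> Rej}" and ?a = "(\<rho> - \<gamma>) * real s"
  let ?M = "M n"
  have fin: "finite ?V" using A by (simp add: structures_def)
  have n: "s \<le> n" using A by (simp add: n_def)
  let ?bad = "{X. X \<subseteq> ?V \<and> card X = s \<and> X \<notin> {X. induced A X \<in> sparse_types \<tau> s ?a P}}"
  have "?bad \<subseteq> {X. X \<subseteq> ?V \<and> card X = s \<and> (\<exists>T\<subseteq>X. ?a \<le> real (card T) \<and> (\<forall>Y\<subseteq>T. card Y = k \<longrightarrow> Y \<notin> ?\<E>))}"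
  proof
    fix X assume "X \<in> ?bad"
    then have X: "X \<subseteq> ?V" "card X = s" and "induced A X \<notin> sparse_types \<tau> s ?a P" by auto
    then obtain T where T: "T \<subseteq> X" "?a \<le> real (card T)" "induced A T \<in> P"
      using induced_in_sparse_types_iff[OF A(1) X] by blast
    have "Y \<notin> ?\<E>" if "Y \<subseteq> T" "card Y = k" for Y
    proof -
      have "induced (induced A T) Y \<notin> Rej"
        using tst T(3) that unfolding one_sided_tester_at_def by simp
      then show ?thesis using that by (simp add: induced_induced)
    qed
    then show "X \<in> {X. X \<subseteq> ?V \<and> card X = s \<and> (\<exists>T\<subseteq>X. ?a \<le> real (card T) \<and> (\<forall>Y\<subseteq>T. card Y = k \<longrightarrow> Y \<notin> ?\<E>))}"
      using X T by blast
  qed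
  then have "real (card ?bad) \<le> real (card {X. X \<subseteq> ?V \<and> card X = s \<and> (\<exists>T\<subseteq>X. ?a \<le> real (card T) \<and> (\<forall>Y\<subseteq>T. card Y = k \<longrightarrow> Y \<notin> ?\<E>))})"
    using fin by (intro of_nat_mono card_mono) auto
  also have "\<dots> \<le> real (n choose s) * (real s ^ (k * Suc R) * exp (- (real s * (\<gamma> / 2)\<^sup>2 / 8)))"
  proof (rule card_samples_with_large_independent_set[OF fin n_def[symmetric] s_bounds(4) n k M_large[OF n]])
    show "real j \<le> p * real n" if "j < ?M" for j using M_bounds(3)[OF n that] .
    show "0 \<le> p" using p_bounds by simp
    show "real n * (1 - 1 / (3 * real k)) ^ R < real ?M" by (rule rounds_suffice[OF n])
    show "0 \<le> \<gamma> / 2" "\<gamma> / 2 \<le> 1 / 2" using \<gamma>_bounds by auto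
    show "real (k * R) \<le> \<gamma> / 2 * real s" by (rule fingerprint_small)
    show "(p + 2 * (\<gamma> / 2)) * real s \<le> ?a" by (simp add: p_def)
    fix Z assume Z: "Z \<subseteq> ?V" "card Z = ?M"
    have "k * 1 \<le> 2 * k\<^sup>2" unfolding power2_eq_square using k by simp
    then have kM: "k \<le> card Z" using M_large[OF n] Z by simp
    have "eps_far \<tau> P (\<epsilon> / (4 * \<rho>\<^sup>2)) (induced A Z)"
      using M_le(2)[OF n] K_bounds[OF n] transplant_cost[OF n] Z
      by (intro far_from_Large_induced_far[OF ar P A(1,3) Z(1), where K = "K n"]) (auto simp: n_def)
    then show "2 / 3 * real (?M choose k) \<le> real (card {Y. Y \<subseteq> Z \<and> card Y = k \<and> Y \<in> ?\<E>})"
      using one_sided_reject_density[OF tst A(1) Z(1) kM] Z by simp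
  qed
  also have "\<dots> \<le> real (n choose s) * (1 / 3)" using soundness_error by (intro mult_left_mono) auto
  finally have "1 - 1 / 3 \<le> reject_prob A s (sparse_types \<tau> s ?a P)"
    unfolding reject_prob_def n_def by (intro prob_random_subset_ge[OF fin A(2)])
  then show ?thesis by simp
qed

end

theorem theorem1p15:
  shows "\<exists>(C::real) (k::nat). C > 0 \<and>
    (\<forall>(\<tau>::signature) (P::nat rel_structure set) (S::real \<Rightarrow> nat) (\<rho>::real) (\<epsilon>::real) (\<delta>::real).
       (\<forall>a\<in>set \<tau>. a = 2) \<longrightarrow>
       is_property \<tau> P \<longrightarrow> P \<noteq> {} \<longrightarrow> hereditary P \<longrightarrow> extendable P \<longrightarrow>
       one_sided_complexity \<tau> P S \<longrightarrow>
       0 < \<rho> \<longrightarrow> \<rho> \<le> 1 \<longrightarrow> 0 < \<epsilon> \<longrightarrow> \<epsilon> \<le> \<rho>\<^sup>2 / 8 \<longrightarrow> \<delta> = \<epsilon> / (4 * \<rho>\<^sup>2) \<longrightarrow>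
       (let X = \<rho>\<^sup>2 / \<epsilon>\<^sup>2 * (real (S \<delta>))\<^sup>2 * ln (2 / \<rho>)
        in \<exists>s Rej. two_sided_tester_at \<tau> (Large \<tau> \<rho> P) \<epsilon> s Rej \<and>
             real s \<le> C * X * (ln X) ^ k))"
proof (rule exI[of _ "2 ^ 22"], rule exI[of _ 1], intro conjI allI impI)
  fix \<tau> :: signature and P :: "nat rel_structure set" and S and \<rho> \<epsilon> \<delta> :: real
  assume ar: "\<forall>a\<in>set \<tau>. a = 2" and P: "is_property \<tau> P" "hereditary P" "extendable P"
    and S: "one_sided_complexity \<tau> P S"
    and \<rho>: "0 < \<rho>" "\<rho> \<le> 1" and \<epsilon>: "0 < \<epsilon>" "\<epsilon> \<le> \<rho>\<^sup>2 / 8" and \<delta>: "\<delta> = \<epsilon> / (4 * \<rho>\<^sup>2)"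
  have "0 < \<delta>" using \<rho> \<epsilon> by (simp add: \<delta>)
  then obtain Rej where tst: "one_sided_tester_at \<tau> P \<delta> (S \<delta>) Rej"
    using S unfolding one_sided_complexity_def by blast
  then have tst': "one_sided_tester_at \<tau> P (\<epsilon> / (4 * \<rho>\<^sup>2)) (S \<delta>) Rej" by (simp only: \<delta>)
  have "0 < S \<delta>" using tst by (simp add: one_sided_tester_at_def sampler_def)
  then interpret tester_params "S \<delta>" \<rho> \<epsilon>
    using \<rho> \<epsilon> by unfold_locales
  have "two_sided_tester_at \<tau> (Large \<tau> \<rho> P) \<epsilon> s (sparse_types \<tau> s ((\<rho> - \<gamma>) * real s) P)"
    unfolding two_sided_tester_at_def sound_at_def
  proof (intro conjI ballI impI)
    show "sampler \<tau> s (sparse_types \<tau> s ((\<rho> - \<gamma>) * real s) P)"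
      using s_bounds(4) by (intro sampler_sparse_types P) auto
    show "2 / 3 \<le> reject_prob A s (sparse_types \<tau> s ((\<rho> - \<gamma>) * real s) P)"
      if "A \<in> structures \<tau>" "s \<le> card (verts A)" "eps_far \<tau> (Large \<tau> \<rho> P) \<epsilon> A" for A
      by (rule sparse_types_rejects_far[OF ar P(1,3) tst' that])
    show "2 / 3 \<le> accept_prob A s (sparse_types \<tau> s ((\<rho> - \<gamma>) * real s) P)"
      if "A \<in> Large \<tau> \<rho> P" "s \<le> card (verts A)" for A
    proof -
      have "1 - exp (- (real s * \<gamma>\<^sup>2 / 4)) \<le> accept_prob A s (sparse_types \<tau> s ((\<rho> - \<gamma>) * real s) P)"
        using that s_bounds(4) \<gamma>_bounds by (intro sparse_types_accepts_Large P) auto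
      then show ?thesis using completeness_error by linarith
    qed
  qed
  moreover have "real s \<le> 2 ^ 22 * X * ln X ^ 1" using s_bounds(3) by simp
  ultimately show "let X = \<rho>\<^sup>2 / \<epsilon>\<^sup>2 * (real (S \<delta>))\<^sup>2 * ln (2 / \<rho>)
        in \<exists>s Rej. two_sided_tester_at \<tau> (Large \<tau> \<rho> P) \<epsilon> s Rej \<and> real s \<le> 2 ^ 22 * X * ln X ^ 1"
    unfolding X_def Let_def by blast
qed simp

end
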